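(* Let $\tau,\gamma\in\Omega_1$ and $\varepsilon>0$. Then the perturbation of $\gamma$ by $\varepsilon\tau$ is $$(\bullet+\varepsilon\tau)\triangleright\gamma=\mathcal{L}_{\exp(\varepsilon\tau)}\gamma,\qquad \exp(\varepsilon\tau)=\mathbf{1}+\varepsilon\tau+\frac{\varepsilon^2}{2}\,\tau\cdot\tau+\frac{\varepsilon^3}{3!}\,\tau\cdot\tau\cdot\tau+\cdots$$ where $\bullet\in\mathcal{F}_1$ is the tree consisting of a single vertex.
   Context: Aromatic trees. Consider finite directed graphs with node set $V$ and oriented edges $E\subset V\times V$ (loops allowed) in which each node is the source of exactly one edge, except for one node, the root, which has no outgoing edge. Nodes may be vertices (indistinguishable) or numbered covertices. A predecessor of $u$ is a node $v$ with $(v,u)\in E$. Let $\mathcal{F}_1$ be the set of isomorphism classes of such graphs with all nodes vertices; the connected component of the root is a tree, the other components (without root) are aromas. Put $\Omega_1=\mathrm{Span}_{\mathbb{R}}(\mathcal{F}_1)$. Substitution at a node. For $\gamma\in\mathcal{F}_1$, a node $v$ of $\gamma$ and $\tau\in\mathcal{F}_1$, let $\mathcal{L}^v_\tau\gamma$ be the sum of all graphs obtained by replacing the node $v$ by $\tau$: the root of $\tau$ inherits the outgoing edge of $v$ (or becomes the root if $v$ is the root), and the predecessors of $v$ are grafted onto the nodes of $\tau$ in all possible ways. (Equivalently, $v$ is replaced by a covertex numbered 1, and this covertex is then contracted with $\tau$.) It is extended linearly in $\tau\in\Omega_1$. The aromatic Lie derivative of $\gamma$ in the direction of $\tau$ is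 $\mathcal{L}_\tau\gamma=\sum_{v\in V}\mathcal{L}^v_\tau\gamma$. Extension to the symmetric algebra. Let $\mathcal{U}(\Omega_1)$ be the symmetric tensor algebra of $\Omega_1$ over $\mathbb{R}$, with symmetric product $\cdot$ (normalised so that $a\cdot b=\frac12(a\otimes b+b\otimes a)$; in particular $\tau\cdot\tau=\tau\otimes\tau$), and unit $\mathbf{1}$. Set $\mathcal{L}_{\mathbf{1}}\gamma=\gamma$ and, for $\tau_1,\dots,\tau_n\in\Omega_1$ and $\gamma\in\mathcal{F}_1$, $$\mathcal{L}_{\tau_n\otimes\cdots\otimes\tau_1}\gamma=\sum_{v_1,\dots,v_n\in V,\ v_i\ne v_j\ (i\neq j)}\mathcal{L}^{v_n}_{\tau_n}\cdots\mathcal{L}^{v_1}_{\tau_1}\gamma,$$ where $V$ is the set of vertices of the original $\gamma$ (the sum is $0$ if $n>|V|$); extended linearly in $\gamma\in\Omega_1$ and in the first argument, including to formal infinite sums such as $\exp(\varepsilon\tau)$ (only finitely many terms act non-trivially on a given $\gamma$). Substitution law. For $\sigma\in\Omega_1$ and $\gamma\in\mathcal{F}_1$ with vertices $v_1,\dots,v_N$, $\sigma\triangleright\gamma$ is obtained by replacing every vertex of $\gamma$ by $\sigma$: $\sigma\triangleright\gamma=\mathcal{L}^{v_N}_\sigma\cdots\mathcal{L}^{v_1}_\sigma\gamma=\frac1{N!}\mathcal{L}_{\sigma^{\otimes N}}\gamma$. It is extended linearly in $\gamma\in\Omega_1$. *)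

theory Defs
  imports
    "HOL-Analysis.Finite_Function_Topology"
    "HOL-Combinatorics.Permutations"
    "Graph_Theory.Pair_Digraph"
    "Graph_Theory.Digraph_Isomorphism"
begin

section \<open>Aromatic trees\<close>

type_synonym graph = "nat pair_pre_digraph"

definition aromatic :: "graph \<Rightarrow> bool" where
  "aromatic G \<longleftrightarrow> pair_fin_digraph G \<and>
     (\<exists>r\<in>pverts G. \<forall>v\<in>pverts G. out_degree (with_proj G) v = (if v = r then 0 else 1))"

definition root_node :: "graph \<Rightarrow> nat" where
  "root_node G = (THE r. r \<in> pverts G \<and> out_degree (with_proj G) r = 0)"

definition aromatic_iso :: "graph \<Rightarrow> graph \<Rightarrow> bool" where
  "aromatic_iso G H \<longleftrightarrow> aromatic G \<and> aromatic H \<and> digraph_iso (with_proj G) (with_proj H)"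

definition bullet_graph :: graph where
  "bullet_graph = \<lparr> pverts = {0}, parcs = {} \<rparr>"

lemma out_degree_with_proj: "out_degree (with_proj G) v = card {e \<in> parcs G. fst e = v}"
  by (simp add: out_degree_def out_arcs_def with_proj_def)

lemma aromatic_bullet_graph: "aromatic bullet_graph"
  by (auto simp: aromatic_def bullet_graph_def out_degree_with_proj intro!: pair_fin_digraph.intro
      pair_wf_digraph.intro pair_fin_digraph_axioms.intro)

lemma aromatic_wf: "aromatic G \<Longrightarrow> wf_digraph (with_proj G)"
  by (simp add: aromatic_def pair_fin_digraph_def wf_digraph_wp_iff)

lemma aromatic_iso_refl:
  assumes "aromatic G"
  shows "aromatic_iso G G"
proof -
  let ?f = "\<lparr>iso_verts = id, iso_arcs = id, iso_head = snd, iso_tail = fst\<rparr>"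
  have "pre_digraph.digraph_isomorphism (with_proj G) ?f"
    using aromatic_wf[OF assms] unfolding pre_digraph.digraph_isomorphism_def
    by (simp add: with_proj_def)
  moreover have "with_proj G = app_iso ?f (with_proj G)"
    by (simp add: app_iso_def with_proj_def)
  ultimately show ?thesis
    using assms unfolding aromatic_iso_def digraph_iso_def by blast
qed

text \<open>
  Every finite directed graph is isomorphic to one whose nodes are natural numbers, so the
  quotient below contains every isomorphism class of graphs without covertices.
\<close>

quotient_type aromatic_tree = graph / partial: aromatic_iso
proof (rule part_equivpI)
  show "\<exists>G. aromatic_iso G G"
    using aromatic_iso_refl aromatic_bullet_graph by blast
  show "symp aromatic_iso"
    by (rule sympI) (auto simp: aromatic_iso_def intro: digraph_iso_swap aromatic_wf)
  show "transp aromatic_iso"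
    by (rule transpI) (auto simp: aromatic_iso_def intro: digraph_iso_trans)
qed

section \<open>Formal linear combinations\<close>

abbreviation basis :: "'a \<Rightarrow> 'a \<Rightarrow>\<^sub>0 real" where
  "basis k \<equiv> Poly_Mapping.single k 1"

definition lin_ext :: "('a \<Rightarrow> 'b::real_vector) \<Rightarrow> ('a \<Rightarrow>\<^sub>0 real) \<Rightarrow> 'b" where
  "lin_ext f x = (\<Sum>k\<in>Poly_Mapping.keys x. Poly_Mapping.lookup x k *\<^sub>R f k)"

lemma lin_ext_eq_sum:
  assumes "finite A" "Poly_Mapping.keys x \<subseteq> A"
  shows "lin_ext f x = (\<Sum>k\<in>A. Poly_Mapping.lookup x k *\<^sub>R f k)"
  unfolding lin_ext_def using assms
  by (intro sum.mono_neutral_left) (auto simp: in_keys_iff)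

lemma lookup_scaleR [simp]: "Poly_Mapping.lookup (c *\<^sub>R x) k = c *\<^sub>R Poly_Mapping.lookup x k"
  by (simp add: scaleR_poly_mapping_def)

lemma linear_lin_ext: "linear (lin_ext f)"
proof (rule linearI)
  fix x y :: "'a \<Rightarrow>\<^sub>0 real" and c :: real
  let ?A = "Poly_Mapping.keys x \<union> Poly_Mapping.keys y"
  have "lin_ext f (x + y) = (\<Sum>k\<in>?A. Poly_Mapping.lookup (x + y) k *\<^sub>R f k)"
    by (rule lin_ext_eq_sum) (auto simp: in_keys_iff lookup_add)
  then show "lin_ext f (x + y) = lin_ext f x + lin_ext f y"
    by (simp add: lin_ext_eq_sum[of ?A] lookup_add scaleR_add_left sum.distrib)
  have "lin_ext f (c *\<^sub>R x) = (\<Sum>k\<in>Poly_Mapping.keys x. Poly_Mapping.lookup (c *\<^sub>R x) k *\<^sub>R f k)"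
    by (rule lin_ext_eq_sum) (auto simp: in_keys_iff)
  then show "lin_ext f (c *\<^sub>R x) = c *\<^sub>R lin_ext f x"
    by (simp add: lin_ext_def scaleR_sum_right)
qed

lemma lin_ext_basis [simp]: "lin_ext f (basis k) = f k"
  by (simp add: lin_ext_def)

type_synonym omega1 = "aromatic_tree \<Rightarrow>\<^sub>0 real"

definition bullet :: omega1 where
  "bullet = basis (abs_aromatic_tree bullet_graph)"

section \<open>Substitution at a node\<close>

text \<open>
  Nodes of a fixed graph must be tracked through iterated substitutions, so these act on concrete
  graphs; isomorphism classes are taken at the end. Before it is inserted, the graph \<open>T\<close> is
  shifted away from the nodes of \<open>G\<close>, so that all nodes of \<open>G\<close> other than \<open>v\<close> keep their names.
\<close>

definition fresh_copy :: "graph \<Rightarrow> graph \<Rightarrow> graph" where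
  "fresh_copy G T = (let s = (\<lambda>u. u + Suc (Max (pverts G))) in
     \<lparr> pverts = s ` pverts T, parcs = map_prod s s ` parcs T \<rparr>)"

definition preds :: "graph \<Rightarrow> nat \<Rightarrow> nat set" where
  "preds G v = {u. (u, v) \<in> parcs G}"

text \<open>
  \<open>f\<close> sends each predecessor of \<open>v\<close> to the node of \<open>T\<close> on which it is grafted. If \<open>v\<close> carries
  a loop, then \<open>v\<close> is its own predecessor, and the loop becomes an arc from the root of \<open>T\<close>
  to \<open>f v\<close>.
\<close>

definition replace_node :: "graph \<Rightarrow> nat \<Rightarrow> graph \<Rightarrow> (nat \<Rightarrow> nat) \<Rightarrow> graph" where
  "replace_node G v T f =
     \<lparr> pverts = (pverts G - {v}) \<union> pverts T,
       parcs = parcs T \<union>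
         (\<lambda>(u, w). (if u = v then root_node T else u, if w = v then f u else w)) ` parcs G \<rparr>"

definition graft_sum :: "nat \<Rightarrow> graph \<Rightarrow> graph \<Rightarrow> graph \<Rightarrow>\<^sub>0 real" where
  "graft_sum v T G = (let T' = fresh_copy G T in
     (\<Sum>f \<in> preds G v \<rightarrow>\<^sub>E pverts T'. basis (replace_node G v T' f)))"

lemma fresh_copy_disjoint:
  assumes "finite (pverts G)"
  shows "pverts G \<inter> pverts (fresh_copy G T) = {}"
proof -
  have "u + Suc (Max (pverts G)) \<notin> pverts G" for u
    using Max_ge[OF assms, of "u + Suc (Max (pverts G))"] by linarith
  then show ?thesis
    unfolding fresh_copy_def Let_def by auto
qed

lemma pair_fin_digraph_iff:
  "pair_fin_digraph G \<longleftrightarrow> finite (pverts G) \<and> parcs G \<subseteq> pverts G \<times> pverts G"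
  unfolding pair_fin_digraph_def pair_fin_digraph_axioms_def pair_wf_digraph_def
  by (auto intro: finite_subset[of _ "pverts G \<times> pverts G"])

lemma out_degree_eq_card: "out_degree (with_proj G) v = card {w. (v, w) \<in> parcs G}"
proof -
  have "{e \<in> parcs G. fst e = v} = Pair v ` {w. (v, w) \<in> parcs G}"
    by force
  then show ?thesis
    by (simp add: out_degree_with_proj card_image inj_on_def)
qed

lemma out_degree_eq_0:
  assumes "pair_fin_digraph G"
  shows "out_degree (with_proj G) v = 0 \<longleftrightarrow> (\<forall>w. (v, w) \<notin> parcs G)"
proof -
  have "finite {w. (v, w) \<in> parcs G}"
    using assms unfolding pair_fin_digraph_iff by (auto intro: finite_subset[of _ "pverts G"])
  then show ?thesis
    by (auto simp: out_degree_eq_card)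
qed

lemma out_degree_eq_1: "out_degree (with_proj G) v = 1 \<longleftrightarrow> (\<exists>!w. (v, w) \<in> parcs G)"
  unfolding out_degree_eq_card One_nat_def card_1_singleton_iff set_eq_iff
  by (metis mem_Collect_eq singleton_iff)

lemma aromatic_root:
  assumes "aromatic G"
  shows "pair_fin_digraph G" "root_node G \<in> pverts G" "(root_node G, w) \<notin> parcs G"
    and "\<And>v. v \<in> pverts G \<Longrightarrow> v \<noteq> root_node G \<Longrightarrow> \<exists>!w. (v, w) \<in> parcs G"
proof -
  show fin: "pair_fin_digraph G"
    using assms by (simp add: aromatic_def)
  from assms obtain r where r: "r \<in> pverts G"
    "\<And>v. v \<in> pverts G \<Longrightarrow> out_degree (with_proj G) v = (if v = r then 0 else 1)"
    unfolding aromatic_def by blast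
  have "root_node G = r"
    unfolding root_node_def using r by (intro the_equality) (auto split: if_splits)
  with r show "root_node G \<in> pverts G" "(root_node G, w) \<notin> parcs G"
    using out_degree_eq_0[OF fin, of r] by auto
  show "\<exists>!w. (v, w) \<in> parcs G" if "v \<in> pverts G" "v \<noteq> root_node G" for v
    using r(2)[OF that(1)] that(2) \<open>root_node G = r\<close> unfolding out_degree_eq_1[symmetric] by simp
qed

lemma aromaticI:
  assumes "pair_fin_digraph G" "r \<in> pverts G" "\<And>w. (r, w) \<notin> parcs G"
    and "\<And>v. v \<in> pverts G \<Longrightarrow> v \<noteq> r \<Longrightarrow> \<exists>!w. (v, w) \<in> parcs G"
  shows "aromatic G"
  unfolding aromatic_def using assms
  by (intro conjI bexI[of _ r] ballI) (simp_all add: out_degree_eq_0 out_degree_eq_1[unfolded One_nat_def])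

lemma aromatic_fresh_copy:
  assumes "aromatic T"
  shows "aromatic (fresh_copy G T)"
proof -
  define s where "s = (\<lambda>u. u + Suc (Max (pverts G)))"
  have fc: "pverts (fresh_copy G T) = s ` pverts T" "parcs (fresh_copy G T) = map_prod s s ` parcs T"
    by (simp_all add: fresh_copy_def s_def Let_def)
  have arc: "(s u, y) \<in> map_prod s s ` parcs T \<longleftrightarrow> (\<exists>w. y = s w \<and> (u, w) \<in> parcs T)" for u y
    by (force simp: s_def)
  note T = aromatic_root[OF assms]
  show ?thesis
  proof (rule aromaticI[of _ "s (root_node T)"])
    show "pair_fin_digraph (fresh_copy G T)"
      using T(1) unfolding pair_fin_digraph_iff fc by auto
    show "s (root_node T) \<in> pverts (fresh_copy G T)"
      using T(2) by (simp add: fc)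
    show "(s (root_node T), w) \<notin> parcs (fresh_copy G T)" for w
      using T(3) by (simp add: fc(2) arc)
  next
    fix v assume "v \<in> pverts (fresh_copy G T)" "v \<noteq> s (root_node T)"
    then obtain u where "v = s u" "u \<in> pverts T" "u \<noteq> root_node T"
      by (auto simp: fc)
    then show "\<exists>!w. (v, w) \<in> parcs (fresh_copy G T)"
      using T(4)[of u] by (auto simp: fc(2) arc)
  qed
qed

lemma aromatic_replace_node:
  assumes "aromatic G" "aromatic T" "v \<in> pverts G" "pverts G \<inter> pverts T = {}"
    and "f \<in> preds G v \<rightarrow>\<^sub>E pverts T"
  shows "aromatic (replace_node G v T f)"
proof -
  note G = aromatic_root[OF assms(1)] and T = aromatic_root[OF assms(2)]
  define h where "h = (\<lambda>u w. if w = v then f u else w)"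
  define a where "a = (\<lambda>u. if u = v then root_node T else u)"
  let ?H = "replace_node G v T f"
  have V: "pverts ?H = (pverts G - {v}) \<union> pverts T"
    by (simp add: replace_node_def)
  have E: "parcs ?H = parcs T \<union> (\<lambda>(u, w). (a u, h u w)) ` parcs G"
    by (simp add: replace_node_def a_def h_def)
  have GE: "u \<in> pverts G \<and> w \<in> pverts G" if "(u, w) \<in> parcs G" for u w
    using G(1) that by (auto simp: pair_fin_digraph_iff)
  have TE: "u \<in> pverts T \<and> w \<in> pverts T" if "(u, w) \<in> parcs T" for u w
    using T(1) that by (auto simp: pair_fin_digraph_iff)
  have ainj: "a u = a u' \<longleftrightarrow> u = u'" if "u \<in> pverts G" "u' \<in> pverts G" for u u'
    using that T(2) assms(4) by (auto simp: a_def)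
  have hV: "h u w \<in> pverts ?H" if "(u, w) \<in> parcs G" for u w
    using GE[OF that] that assms(5) by (auto simp: h_def V preds_def)
  have aV: "a u \<in> pverts ?H" if "u \<in> pverts G" for u
    using that T(2) by (auto simp: a_def V)
  have aE: "(a u, y) \<in> parcs ?H \<longleftrightarrow> (\<exists>w. y = h u w \<and> (u, w) \<in> parcs G)" if "u \<in> pverts G" for u y
  proof -
    have "(a u, y) \<notin> parcs T"
      using that T(3) TE assms(4) by (auto simp: a_def)
    then have "(a u, y) \<in> parcs ?H \<longleftrightarrow> (\<exists>u' w. a u = a u' \<and> y = h u' w \<and> (u', w) \<in> parcs G)"
      unfolding E by force
    then show ?thesis
      using ainj[OF that] GE by metis
  qed
  have tE: "(t, y) \<in> parcs ?H \<longleftrightarrow> (t, y) \<in> parcs T" if "t \<in> pverts T" "t \<noteq> root_node T" for t y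
  proof -
    have "a u \<noteq> t" if "u \<in> pverts G" for u
      using that \<open>t \<in> pverts T\<close> \<open>t \<noteq> root_node T\<close> assms(4) by (auto simp: a_def)
    then show ?thesis
      using GE unfolding E by force
  qed
  show ?thesis
  proof (rule aromaticI[of _ "a (root_node G)"])
    have "(\<lambda>(u, w). (a u, h u w)) ` parcs G \<subseteq> pverts ?H \<times> pverts ?H"
      using hV aV GE by fast
    moreover have "parcs T \<subseteq> pverts ?H \<times> pverts ?H"
      using TE by (auto simp: V)
    ultimately have "parcs ?H \<subseteq> pverts ?H \<times> pverts ?H"
      unfolding E by blast
    then show "pair_fin_digraph ?H"
      using G(1) T(1) by (auto simp: pair_fin_digraph_iff V)
    show "a (root_node G) \<in> pverts ?H"
      using aV G(2) by blast
    show "(a (root_node G), w) \<notin> parcs ?H" for w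
      using aE[OF G(2)] G(3) by blast
  next
    fix x assume x: "x \<in> pverts ?H" "x \<noteq> a (root_node G)"
    show "\<exists>!w. (x, w) \<in> parcs ?H"
    proof (cases "x \<in> pverts T \<and> x \<noteq> root_node T")
      case True
      then show ?thesis
        using T(4)[of x] tE[of x] by simp
    next
      case False
      then have "\<exists>u\<in>pverts G. x = a u"
        using x(1) assms(3) by (auto simp: V a_def)
      then obtain u where u: "u \<in> pverts G" "x = a u"
        by blast
      then have "\<exists>!w. (u, w) \<in> parcs G"
        using G(4)[of u] x(2) by auto
      then show ?thesis
        using u by (auto simp: aE)
    qed
  qed
qed

definition lie_node :: "nat \<Rightarrow> omega1 \<Rightarrow> (graph \<Rightarrow>\<^sub>0 real) \<Rightarrow> (graph \<Rightarrow>\<^sub>0 real)" where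
  "lie_node v \<tau> = lin_ext (\<lambda>G. lin_ext (\<lambda>t. graft_sum v (rep_aromatic_tree t) G) \<tau>)"

definition iso_classes :: "(graph \<Rightarrow>\<^sub>0 real) \<Rightarrow> omega1" where
  "iso_classes = lin_ext (\<lambda>G. basis (abs_aromatic_tree G))"

section \<open>Substitution law\<close>

definition substitute_all :: "omega1 \<Rightarrow> aromatic_tree \<Rightarrow> omega1" where
  "substitute_all \<sigma> g = (let G = rep_aromatic_tree g in
     iso_classes (fold (\<lambda>v. lie_node v \<sigma>) (sorted_list_of_set (pverts G)) (basis G)))"

definition substitution :: "omega1 \<Rightarrow> omega1 \<Rightarrow> omega1" (infixr "\<triangleright>" 75) where
  "\<sigma> \<triangleright> \<gamma> = lin_ext (substitute_all \<sigma>) \<gamma>"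

section \<open>Symmetric tensors over the span of aromatic trees\<close>

text \<open>
  The tensor algebra has the words in aromatic trees as a basis: the word \<open>[t\<^sub>n, \<dots>, t\<^sub>1]\<close> stands
  for \<open>t\<^sub>n \<otimes> \<cdots> \<otimes> t\<^sub>1\<close>. The symmetric algebra is its subspace of symmetric tensors, with the
  symmetrised tensor product.
\<close>

type_synonym tensor = "aromatic_tree list \<Rightarrow>\<^sub>0 real"

definition tensor_prod :: "tensor \<Rightarrow> tensor \<Rightarrow> tensor" (infixr "\<otimes>" 70) where
  "a \<otimes> b = lin_ext (\<lambda>u. lin_ext (\<lambda>w. basis (u @ w)) b) a"

definition symmetrize :: "tensor \<Rightarrow> tensor" where
  "symmetrize = lin_ext (\<lambda>w. (1 / fact (length w)) *\<^sub>R
     (\<Sum>\<pi> | \<pi> permutes {..<length w}. basis (permute_list \<pi> w)))"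

definition sym_prod :: "tensor \<Rightarrow> tensor \<Rightarrow> tensor" (infixr "\<odot>" 70) where
  "a \<odot> b = symmetrize (a \<otimes> b)"

definition sym_one :: tensor ("\<one>") where
  "\<one> = basis []"

definition tensor_of :: "omega1 \<Rightarrow> tensor" where
  "tensor_of = lin_ext (\<lambda>t. basis [t])"

lemma sym_prod_degree_one:
  "tensor_of x \<odot> tensor_of y =
     (1/2) *\<^sub>R (tensor_of x \<otimes> tensor_of y + tensor_of y \<otimes> tensor_of x)"
proof -
  define X where "X = Poly_Mapping.keys x"
  define Y where "Y = Poly_Mapping.keys y"
  define lx where "lx = Poly_Mapping.lookup x"
  define ly where "ly = Poly_Mapping.lookup y"
  have lin: "lin_ext g (tensor_of z) = lin_ext (\<lambda>t. g [t]) z" for g :: "_ \<Rightarrow> tensor" and z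
    by (simp add: tensor_of_def lin_ext_def[of _ z] linear_sum[OF linear_lin_ext]
        linear_scale[OF linear_lin_ext])
  have prod: "tensor_of u \<otimes> tensor_of w = lin_ext (\<lambda>s. lin_ext (\<lambda>t. basis [s, t]) w) u" for u w
    by (simp add: tensor_prod_def lin)
  have perms: "{\<pi>. \<pi> permutes {..<Suc (Suc 0)}} = {id, Transposition.transpose 0 1}"
  proof -
    have "{..<Suc (Suc 0)} = insert 0 {1::nat}" by auto
    moreover have "{(b, p). b \<in> insert 0 {1::nat} \<and> p \<in> {p. p permutes {1::nat}}} = {(0, id), (1, id)}"
      by auto
    ultimately show ?thesis
      using permutes_insert[of "0::nat" "{1}"] by simp
  qed
  have neq: "id \<noteq> Transposition.transpose (0::nat) 1"
    by (metis id_apply transpose_apply_first zero_neq_one)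
  have sym2: "symmetrize (basis [s, t]) = (1/2) *\<^sub>R (basis [s, t] + basis [t, s])" for s t
    using neq by (simp add: symmetrize_def perms permute_list_def numeral_2_eq_2)
  have "tensor_of x \<odot> tensor_of y = (\<Sum>s\<in>X. \<Sum>t\<in>Y. (lx s * ly t) *\<^sub>R symmetrize (basis [s, t]))"
    unfolding sym_prod_def prod
    by (simp add: lin_ext_def[of _ x] lin_ext_def[of _ y] X_def Y_def lx_def ly_def symmetrize_def
        linear_sum[OF linear_lin_ext] linear_scale[OF linear_lin_ext] scaleR_sum_right del: lin_ext_basis)
  also have "\<dots> = (1/2) *\<^sub>R ((\<Sum>s\<in>X. \<Sum>t\<in>Y. (lx s * ly t) *\<^sub>R basis [s, t])
                 + (\<Sum>s\<in>X. \<Sum>t\<in>Y. (lx s * ly t) *\<^sub>R basis [t, s]))"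
    unfolding sym2 by (simp add: scaleR_add_right sum.distrib scaleR_sum_right mult.commute)
  also have "(\<Sum>s\<in>X. \<Sum>t\<in>Y. (lx s * ly t) *\<^sub>R basis [s, t]) = tensor_of x \<otimes> tensor_of y"
    unfolding prod by (simp add: lin_ext_def X_def Y_def lx_def ly_def scaleR_sum_right)
  also have "(\<Sum>s\<in>X. \<Sum>t\<in>Y. (lx s * ly t) *\<^sub>R basis [t, s]) = tensor_of y \<otimes> tensor_of x"
    unfolding prod by (subst sum.swap) (simp add: lin_ext_def X_def Y_def lx_def ly_def scaleR_sum_right mult.commute)
  finally show ?thesis .
qed

primrec sym_power :: "tensor \<Rightarrow> nat \<Rightarrow> tensor" where
  "sym_power a 0 = \<one>"
| "sym_power a (Suc n) = a \<odot> sym_power a n"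

text \<open>Formal infinite sums of tensors are represented by the sequence of their summands.\<close>

definition sym_exp :: "tensor \<Rightarrow> nat \<Rightarrow> tensor" where
  "sym_exp a n = (1 / fact n) *\<^sub>R sym_power a n"

section \<open>Aromatic Lie derivative\<close>

definition lie_word :: "omega1 list \<Rightarrow> aromatic_tree \<Rightarrow> omega1" where
  "lie_word ts g = (let G = rep_aromatic_tree g in
     (\<Sum>vs | length vs = length ts \<and> distinct vs \<and> set vs \<subseteq> pverts G.
        iso_classes (foldr (\<lambda>(v, \<tau>). lie_node v \<tau>) (zip vs ts) (basis G))))"

definition lie_tensor :: "tensor \<Rightarrow> omega1 \<Rightarrow> omega1" where
  "lie_tensor A \<gamma> = lin_ext (\<lambda>g. lin_ext (\<lambda>w. lie_word (map basis w) g) A) \<gamma>"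

text \<open>
  \<open>Sum_any\<close> sums over the indices with a nonzero summand. If \<open>A n\<close> is homogeneous of degree
  \<open>n\<close>, as for \<open>sym_exp\<close> of an element of degree one, then these are finitely many.
\<close>

definition lie_series :: "(nat \<Rightarrow> tensor) \<Rightarrow> omega1 \<Rightarrow> omega1" where
  "lie_series A \<gamma> = Sum_any (\<lambda>n. lie_tensor (A n) \<gamma>)"

end

theory Submission
  imports
    Defs
    "HOL-Combinatorics.Multiset_Permutations"
begin

text \<open>
  Write \<open>x = \<epsilon>\<tau>\<close> and let \<open>G\<close> be a graph with node set \<open>V\<close>. Three facts about insertion at the nodes
  of \<open>G\<close> carry the proof.

  \<^item> Insertion is linear in what is inserted (\<open>linear_plug_slot\<close>).
  \<^item> Inserting a single vertex only renames the node that it replaces (\<open>plug_bullet\<close>).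
  \<^item> Insertions at distinct nodes commute after passing to isomorphism classes
    (\<open>plug_mset_cong\<close>), so inserting \<open>x\<close> at the nodes of a set \<open>S \<subseteq> V\<close> has a result \<open>x[S]\<close>
    that depends on \<open>S\<close> alone.

  By the first two facts, inserting \<open>\<bullet> + x\<close> at every node expands, as a product of sums does, into
  \<open>\<Sum>\<^bsub>S \<subseteq> V\<^esub> x[S]\<close> (\<open>plug_bullet_plus\<close>). On the other side, the \<open>n\<close>-th symmetric power of \<open>x\<close> is
  the tensor power of \<open>x\<close>, because a tensor power is already symmetric, and the Lie derivative along
  it sums \<open>x[{v\<^sub>1,\<dots>,v\<^sub>n}]\<close> over the injective \<open>n\<close>-tuples in \<open>V\<close>. Every \<open>S\<close> with \<open>n\<close> elements is
  enumerated by \<open>n!\<close> such tuples, and the exponential divides by \<open>n!\<close>; hence its degree \<open>n\<close> part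
  contributes the sum of \<open>x[S]\<close> over the \<open>S\<close> with \<open>n\<close> elements, and all degrees together give the same
  sum over all subsets.

  The real work is the commutation. Insertion is defined with a particular fresh copy of the inserted
  graph, whose node names depend on the insertions done before. Since results count only up to
  isomorphism, any other disjoint copy may be used instead (\<open>plug_Cons_basis\<close>). Once disjoint copies
  for two nodes are fixed in advance, both orders of insertion produce literally the same graphs,
  described by a formula that is symmetric in the two nodes (\<open>replace_node_replace_node\<close>).
\<close>

section \<open>Linear extensions\<close>

lemma lin_ext_linear_comp:
  assumes "linear L"
  shows "L (lin_ext g x) = lin_ext (\<lambda>k. L (g k)) x"
  by (simp add: lin_ext_def linear_sum[OF assms] linear_scale[OF assms])

lemma lin_ext_basis_id [simp]:
  fixes x :: "'a \<Rightarrow>\<^sub>0 real"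
  shows "lin_ext basis x = x"
proof (rule poly_mapping_eqI)
  fix k :: 'a
  have L: "linear (\<lambda>y :: 'a \<Rightarrow>\<^sub>0 real. Poly_Mapping.lookup y k)"
    by (rule linearI) (simp_all add: lookup_add)
  show "Poly_Mapping.lookup (lin_ext basis x) k = Poly_Mapping.lookup x k"
    unfolding lin_ext_linear_comp[OF L]
    by (simp add: lin_ext_def lookup_single when_def if_distrib[of "(*) _"] in_keys_iff cong: if_cong)
qed

lemma linear_eq_lin_ext:
  assumes "linear L"
  shows "lin_ext (\<lambda>k. L (basis k)) x = L x"
  using lin_ext_linear_comp[OF assms, of basis x] by simp

lemma lin_ext_swap:
  "lin_ext (\<lambda>t. lin_ext (\<lambda>s. h t s) y) x = lin_ext (\<lambda>s. lin_ext (\<lambda>t. h t s) x) y"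
  unfolding lin_ext_def scaleR_sum_right by (subst sum.swap) (simp add: mult.commute)

lemma sum_lin_ext: "(\<Sum>i\<in>I. lin_ext (f i) x) = lin_ext (\<lambda>k. \<Sum>i\<in>I. f i k) x"
  unfolding lin_ext_def scaleR_sum_right by (rule sum.swap)

lemma lin_ext_cong: "(\<And>k. k \<in> Poly_Mapping.keys x \<Longrightarrow> f k = g k) \<Longrightarrow> lin_ext f x = lin_ext g x"
  by (simp add: lin_ext_def)

section \<open>Relabelling the nodes of a graph\<close>

definition map_graph :: "(nat \<Rightarrow> nat) \<Rightarrow> graph \<Rightarrow> graph" where
  "map_graph \<phi> G = \<lparr> pverts = \<phi> ` pverts G, parcs = map_prod \<phi> \<phi> ` parcs G \<rparr>"

lemma pverts_map_graph [simp]: "pverts (map_graph \<phi> G) = \<phi> ` pverts G"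
  and parcs_map_graph [simp]: "parcs (map_graph \<phi> G) = map_prod \<phi> \<phi> ` parcs G"
  by (simp_all add: map_graph_def)

lemma aromatic_arcD:
  assumes "aromatic G" "(u, w) \<in> parcs G"
  shows "u \<in> pverts G" "w \<in> pverts G"
  using assms aromatic_root(1)[OF assms(1)] by (auto simp: pair_fin_digraph_iff)

lemma finite_pverts: "aromatic G \<Longrightarrow> finite (pverts G)"
  using aromatic_root(1) by (simp add: pair_fin_digraph_iff)

lemma preds_subset: "aromatic G \<Longrightarrow> preds G v \<subseteq> pverts G"
  by (auto simp: preds_def dest: aromatic_arcD)

lemma root_node_eqI:
  assumes "aromatic G" "r \<in> pverts G" "\<And>w. (r, w) \<notin> parcs G"
  shows "root_node G = r"
  using aromatic_root(4)[OF assms(1,2)] assms(3) by blast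

text \<open>
  Arcs of the image can be lifted along \<open>\<phi>\<close> although \<open>\<phi>\<close> is injective only on the nodes of \<open>G\<close>,
  because all arcs of an aromatic graph join nodes of it.
\<close>

lemma map_graph_arc_iff:
  assumes "aromatic G" "inj_on \<phi> (pverts G)" "u \<in> pverts G"
  shows "(\<phi> u, y) \<in> parcs (map_graph \<phi> G) \<longleftrightarrow> (\<exists>w. y = \<phi> w \<and> (u, w) \<in> parcs G)"
proof
  assume "(\<phi> u, y) \<in> parcs (map_graph \<phi> G)"
  then obtain u' w where "\<phi> u = \<phi> u'" "y = \<phi> w" "(u', w) \<in> parcs G"
    by auto
  moreover from this have "u' = u"
    using inj_onD[OF assms(2)] aromatic_arcD(1)[OF assms(1)] assms(3) by metis
  ultimately show "\<exists>w. y = \<phi> w \<and> (u, w) \<in> parcs G"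
    by blast
qed (auto intro: rev_image_eqI)

lemma aromatic_map_graph:
  assumes "aromatic G" "inj_on \<phi> (pverts G)"
  shows "aromatic (map_graph \<phi> G)"
proof -
  note G = aromatic_root[OF assms(1)]
  note arc = map_graph_arc_iff[OF assms]
  show ?thesis
  proof (rule aromaticI[of _ "\<phi> (root_node G)"])
    show "pair_fin_digraph (map_graph \<phi> G)"
      using G(1) unfolding pair_fin_digraph_iff by auto
    show "\<phi> (root_node G) \<in> pverts (map_graph \<phi> G)"
      using G(2) by simp
    show "(\<phi> (root_node G), w) \<notin> parcs (map_graph \<phi> G)" for w
      using G(3) arc[OF G(2), of w] by blast
  next
    fix v assume "v \<in> pverts (map_graph \<phi> G)" "v \<noteq> \<phi> (root_node G)"
    then obtain u where "v = \<phi> u" "u \<in> pverts G" "u \<noteq> root_node G"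
      by auto
    then show "\<exists>!w. (v, w) \<in> parcs (map_graph \<phi> G)"
      using G(4)[of u] arc[of u] by metis
  qed
qed

lemma root_node_map_graph:
  assumes "aromatic G" "inj_on \<phi> (pverts G)"
  shows "root_node (map_graph \<phi> G) = \<phi> (root_node G)"
proof (rule root_node_eqI[OF aromatic_map_graph[OF assms]])
  show "\<phi> (root_node G) \<in> pverts (map_graph \<phi> G)"
    using aromatic_root(2)[OF assms(1)] by simp
  show "(\<phi> (root_node G), w) \<notin> parcs (map_graph \<phi> G)" for w
    using map_graph_arc_iff[OF assms, of "root_node G" w] aromatic_root(2,3)[OF assms(1)] by blast
qed

lemma preds_map_graph:
  assumes "aromatic G" "inj_on \<phi> (pverts G)" "v \<in> pverts G"
  shows "preds (map_graph \<phi> G) (\<phi> v) = \<phi> ` preds G v"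
proof (intro set_eqI iffI)
  fix y assume "y \<in> preds (map_graph \<phi> G) (\<phi> v)"
  then obtain u w where "y = \<phi> u" "\<phi> v = \<phi> w" "(u, w) \<in> parcs G"
    by (auto simp: preds_def)
  moreover from this have "w = v"
    using inj_onD[OF assms(2)] aromatic_arcD(2)[OF assms(1)] assms(3) by metis
  ultimately show "y \<in> \<phi> ` preds G v"
    by (auto simp: preds_def)
qed (auto simp: preds_def intro: rev_image_eqI)

lemma aromatic_iso_map_graph:
  assumes "aromatic G" "inj_on \<phi> (pverts G)"
  shows "aromatic_iso G (map_graph \<phi> G)"
proof -
  let ?h = "\<lparr>iso_verts = \<phi>, iso_arcs = map_prod \<phi> \<phi>, iso_head = snd, iso_tail = fst\<rparr>"
  have "inj_on (map_prod \<phi> \<phi>) (parcs G)"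
    using inj_onD[OF assms(2)] aromatic_arcD[OF assms(1)] by (force intro!: inj_onI)
  then have "pre_digraph.digraph_isomorphism (with_proj G) ?h"
    using aromatic_wf[OF assms(1)] assms(2) unfolding pre_digraph.digraph_isomorphism_def
    by (simp add: with_proj_def)
  moreover have "with_proj (map_graph \<phi> G) = app_iso ?h (with_proj G)"
    by (simp add: app_iso_def with_proj_def)
  ultimately show ?thesis
    using assms aromatic_map_graph unfolding aromatic_iso_def digraph_iso_def by blast
qed

text \<open>
  An isomorphism in \<open>digraph_iso\<close> also carries a map of arcs. In a graph without parallel arcs an arc
  is the pair of its ends, so the map of nodes determines it, and relabelling nodes accounts for all
  isomorphisms.
\<close>

lemma aromatic_isoE:
  assumes "aromatic_iso G H"
  obtains \<phi> where "inj_on \<phi> (pverts G)" "H = map_graph \<phi> G"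
proof -
  obtain h where h: "pre_digraph.digraph_isomorphism (with_proj G) h"
    and H: "with_proj H = app_iso h (with_proj G)"
    using assms unfolding aromatic_iso_def digraph_iso_def by blast
  have inj: "inj_on (iso_verts h) (pverts G)"
    using h unfolding pre_digraph.digraph_isomorphism_def by (simp add: with_proj_def)
  have "iso_head h = snd" "iso_tail h = fst" "pverts H = iso_verts h ` pverts G"
    and E: "parcs H = iso_arcs h ` parcs G"
    using H by (simp_all add: app_iso_def with_proj_def)
  then have "iso_arcs h a = map_prod (iso_verts h) (iso_verts h) a" if "a \<in> parcs G" for a
    using h that unfolding pre_digraph.digraph_isomorphism_def
    by (auto simp: with_proj_def prod_eq_iff)
  then have "H = map_graph (iso_verts h) G"
    using E \<open>pverts H = _\<close> by (simp add: map_graph_def cong: image_cong)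
  with inj show ?thesis using that by blast
qed

lemma abs_aromatic_tree_eq_iff:
  assumes "aromatic G" "aromatic H"
  shows "abs_aromatic_tree G = abs_aromatic_tree H \<longleftrightarrow> aromatic_iso G H"
  using Quotient3_rel[OF Quotient3_aromatic_tree] assms aromatic_iso_refl by metis

lemma aromatic_rep: "aromatic (rep_aromatic_tree t)"
  using Quotient3_rep_reflp[OF Quotient3_aromatic_tree] by (simp add: aromatic_iso_def)

lemma abs_rep: "abs_aromatic_tree (rep_aromatic_tree t) = t"
  by (rule Quotient3_abs_rep[OF Quotient3_aromatic_tree])

lemma fresh_copy_eq_map_graph: "\<exists>\<phi>. inj \<phi> \<and> fresh_copy G T = map_graph \<phi> T"
  by (rule exI[of _ "\<lambda>u. u + Suc (Max (pverts G))"])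
    (simp add: fresh_copy_def map_graph_def inj_def Let_def)

lemma abs_fresh_copy:
  assumes "aromatic T"
  shows "abs_aromatic_tree (fresh_copy G T) = abs_aromatic_tree T"
proof -
  obtain \<phi> where "inj \<phi>" "fresh_copy G T = map_graph \<phi> T"
    using fresh_copy_eq_map_graph by blast
  then show ?thesis
    using abs_aromatic_tree_eq_iff[OF assms aromatic_fresh_copy[OF assms]]
      aromatic_iso_map_graph[OF assms] inj_on_subset by (metis top_greatest)
qed

lemma disjoint_representative:
  assumes "finite X"
  obtains T where "aromatic T" "abs_aromatic_tree T = t" "X \<inter> pverts T = {}"
  using that[of "fresh_copy \<lparr>pverts = X, parcs = {}\<rparr> (rep_aromatic_tree t)"]
    fresh_copy_disjoint[of "\<lparr>pverts = X, parcs = {}\<rparr>"] aromatic_fresh_copy abs_fresh_copy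
    aromatic_rep abs_rep assms by simp

section \<open>Substitution and relabelling\<close>

lemma sum_PiE_reindex:
  assumes "inj_on a A" "inj_on b B"
  shows "(\<Sum>g \<in> a ` A \<rightarrow>\<^sub>E b ` B. h g)
    = (\<Sum>f \<in> A \<rightarrow>\<^sub>E B. h (\<lambda>y\<in>a ` A. b (f (inv_into A a y))))"
proof (rule sum.reindex_bij_witness[where
      i = "\<lambda>f. \<lambda>y\<in>a ` A. b (f (inv_into A a y))" and j = "\<lambda>g. \<lambda>x\<in>A. inv_into B b (g (a x))"])
  fix g assume g: "g \<in> a ` A \<rightarrow>\<^sub>E b ` B"
  then have gA: "g (a x) \<in> b ` B" if "x \<in> A" for x
    using that by blast
  show eq: "(\<lambda>y\<in>a ` A. b ((\<lambda>x\<in>A. inv_into B b (g (a x))) (inv_into A a y))) = g"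
  proof (rule PiE_ext[OF _ g])
    show "(\<lambda>y\<in>a ` A. b ((\<lambda>x\<in>A. inv_into B b (g (a x))) (inv_into A a y))) \<in> a ` A \<rightarrow>\<^sub>E b ` B"
      using gA assms by (auto simp: f_inv_into_f)
  qed (use gA assms in \<open>auto simp: f_inv_into_f\<close>)
  show "(\<lambda>x\<in>A. inv_into B b (g (a x))) \<in> A \<rightarrow>\<^sub>E B"
    using gA by (auto intro: inv_into_into)
  show "h (\<lambda>y\<in>a ` A. b ((\<lambda>x\<in>A. inv_into B b (g (a x))) (inv_into A a y))) = h g"
    by (simp only: eq)
next
  fix f assume f: "f \<in> A \<rightarrow>\<^sub>E B"
  show "(\<lambda>x\<in>A. inv_into B b ((\<lambda>y\<in>a ` A. b (f (inv_into A a y))) (a x))) = f"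
    by (rule PiE_ext[OF _ f]) (use f assms in \<open>auto simp: inv_into_f_f[OF assms(2) PiE_mem[OF f]]\<close>)
  show "(\<lambda>y\<in>a ` A. b (f (inv_into A a y))) \<in> a ` A \<rightarrow>\<^sub>E b ` B"
    using f assms by auto
qed

text \<open>
  Replacing a node is natural: relabelling \<open>G\<close> and \<open>T\<close> by one injection relabels the result, provided
  that the grafting function is transported along. Since it is a function on the predecessors of
  \<open>v\<close>, its transport has to be read through the inverse of \<open>\<chi>\<close>.
\<close>

lemma replace_node_map_graph:
  assumes "aromatic G" "aromatic T" "v \<in> pverts G" "pverts G \<inter> pverts T = {}"
    and inj: "inj_on \<chi> (pverts G \<union> pverts T)" and f: "f \<in> preds G v \<rightarrow>\<^sub>E pverts T"
  shows "replace_node (map_graph \<chi> G) (\<chi> v) (map_graph \<chi> T)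
      (\<lambda>y\<in>\<chi> ` preds G v. \<chi> (f (inv_into (preds G v) \<chi> y)))
    = map_graph \<chi> (replace_node G v T f)" (is "replace_node _ _ _ ?f = _")
proof -
  have injG: "inj_on \<chi> (pverts G)" and injT: "inj_on \<chi> (pverts T)"
    using inj by (auto intro: inj_on_subset)
  have injP: "inj_on \<chi> (preds G v)"
    using injG preds_subset[OF assms(1)] by (rule inj_on_subset)
  have V: "(\<chi> ` pverts G - {\<chi> v}) = \<chi> ` (pverts G - {v})"
    using injG assms(3) by (auto simp: inj_on_eq_iff)
  have "(\<lambda>(u, w). (if u = \<chi> v then \<chi> (root_node T) else u, if w = \<chi> v then ?f u else w))
        (map_prod \<chi> \<chi> e)
      = map_prod \<chi> \<chi> ((\<lambda>(u, w). (if u = v then root_node T else u, if w = v then f u else w)) e)"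
    if "e \<in> parcs G" for e
  proof -
    obtain u w where e: "e = (u, w)" by (cases e)
    then have uw: "u \<in> pverts G" "w \<in> pverts G" "w = v \<Longrightarrow> u \<in> preds G v"
      using that aromatic_arcD[OF assms(1)] by (auto simp: preds_def)
    then have "\<chi> u = \<chi> v \<longleftrightarrow> u = v" "\<chi> w = \<chi> v \<longleftrightarrow> w = v"
      using assms(3) injG by (auto simp: inj_on_eq_iff)
    then show ?thesis
      using uw(3) injP by (auto simp: e)
  qed
  then show ?thesis
    unfolding replace_node_def root_node_map_graph[OF assms(2) injT]
    by (simp add: map_graph_def V image_Un image_image cong: image_cong)
qed

lemma sum_replace_node_map_graph:
  assumes "aromatic G" "aromatic T" "v \<in> pverts G" "pverts G \<inter> pverts T = {}"
    and inj: "inj_on \<chi> (pverts G \<union> pverts T)"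
  shows "(\<Sum>f \<in> preds (map_graph \<chi> G) (\<chi> v) \<rightarrow>\<^sub>E pverts (map_graph \<chi> T).
        h (replace_node (map_graph \<chi> G) (\<chi> v) (map_graph \<chi> T) f))
    = (\<Sum>f \<in> preds G v \<rightarrow>\<^sub>E pverts T. h (map_graph \<chi> (replace_node G v T f)))"
proof -
  have injG: "inj_on \<chi> (pverts G)" and injT: "inj_on \<chi> (pverts T)"
    using inj by (auto intro: inj_on_subset)
  have injP: "inj_on \<chi> (preds G v)"
    using injG preds_subset[OF assms(1)] by (rule inj_on_subset)
  show ?thesis
    unfolding preds_map_graph[OF assms(1) injG assms(3)] pverts_map_graph
      sum_PiE_reindex[OF injP injT]
    by (rule sum.cong) (simp_all add: replace_node_map_graph[OF assms])
qed

text \<open>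
  Isomorphisms of the host graph and of the inserted graph, found independently, are combined into
  the single injection that the naturality of replacement asks for.
\<close>

lemma glue_injections:
  fixes \<phi> \<psi> :: "nat \<Rightarrow> nat"
  assumes "inj_on \<phi> (pverts G)" "inj_on \<psi> (pverts T)" "pverts G \<inter> pverts T = {}"
    and "\<phi> ` pverts G \<inter> \<psi> ` pverts T = {}" "aromatic G" "aromatic T"
  obtains \<chi> where "inj_on \<chi> (pverts G \<union> pverts T)" "\<And>u. u \<in> pverts G \<Longrightarrow> \<chi> u = \<phi> u"
    "map_graph \<chi> G = map_graph \<phi> G" "map_graph \<chi> T = map_graph \<psi> T"
proof -
  define \<chi> where "\<chi> u = (if u \<in> pverts G then \<phi> u else \<psi> u)" for u
  have G: "\<chi> u = \<phi> u" if "u \<in> pverts G" for u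
    using that by (simp add: \<chi>_def)
  have T: "\<chi> u = \<psi> u" if "u \<in> pverts T" for u
    using that assms(3) by (auto simp: \<chi>_def)
  have "inj_on \<chi> (pverts G \<union> pverts T)"
  proof -
    have "\<chi> ` pverts G = \<phi> ` pverts G" "\<chi> ` pverts T = \<psi> ` pverts T"
      using G T by simp_all
    moreover have "inj_on \<chi> (pverts G)" "inj_on \<chi> (pverts T)"
      using assms(1,2) G T inj_on_cong[of _ \<chi>] by metis+
    ultimately show ?thesis
      using assms(4) unfolding inj_on_Un by blast
  qed
  moreover have "map_graph \<chi> H = map_graph \<theta> H"
    if "aromatic H" "\<And>u. u \<in> pverts H \<Longrightarrow> \<chi> u = \<theta> u" for H \<theta>
  proof -
    have "map_prod \<chi> \<chi> e = map_prod \<theta> \<theta> e" if "e \<in> parcs H" for e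
      using that aromatic_arcD[OF \<open>aromatic H\<close>] \<open>\<And>u. u \<in> pverts H \<Longrightarrow> \<chi> u = \<theta> u\<close> by (cases e) auto
    then show ?thesis
      using that(2) by (simp add: map_graph_def cong: image_cong)
  qed
  ultimately show ?thesis
    using that[of \<chi>] G T assms(5,6) by blast
qed

section \<open>Insertion at a list of nodes\<close>

definition plug :: "(nat \<times> omega1) list \<Rightarrow> graph \<Rightarrow> omega1" where
  "plug ps G = iso_classes (fold (\<lambda>(v, \<sigma>). lie_node v \<sigma>) ps (basis G))"

lemma linear_iso_classes_fold:
  "linear (\<lambda>x. iso_classes (fold (\<lambda>(v, \<sigma>). lie_node v \<sigma>) ps x))"
proof (induction ps)
  case Nil
  then show ?case by (simp add: iso_classes_def linear_lin_ext)
next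
  case (Cons p ps)
  then show ?case
    using linear_compose[OF linear_lin_ext Cons.IH]
    by (simp add: o_def lie_node_def split_beta)
qed

lemma plug_Nil: "plug [] G = basis (abs_aromatic_tree G)"
  by (simp add: plug_def iso_classes_def)

text \<open>
  The recursion on concrete graphs behind the linear operators: the first insertion produces a sum
  of graphs, in each of which the remaining nodes survive under their old names.
\<close>

lemma plug_Cons:
  "plug ((v, \<sigma>) # ps) G = lin_ext (\<lambda>t. \<Sum>f \<in> preds G v \<rightarrow>\<^sub>E pverts (fresh_copy G (rep_aromatic_tree t)).
     plug ps (replace_node G v (fresh_copy G (rep_aromatic_tree t)) f)) \<sigma>"
proof -
  have "lie_node v \<sigma> (basis G) = lin_ext (\<lambda>t. graft_sum v (rep_aromatic_tree t) G) \<sigma>"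
    by (simp add: lie_node_def)
  then show ?thesis
    by (simp add: plug_def lin_ext_linear_comp[OF linear_iso_classes_fold]
        graft_sum_def Let_def linear_sum[OF linear_iso_classes_fold])
qed

lemma plug_Cons_lin_ext: "plug ((v, \<sigma>) # ps) G = lin_ext (\<lambda>t. plug ((v, basis t) # ps) G) \<sigma>"
  by (simp add: plug_Cons)

text \<open>
  A node disappears when something is inserted at it, so an iterated insertion makes sense only at
  pairwise distinct nodes.
\<close>

definition pluggable :: "(nat \<times> omega1) list \<Rightarrow> graph \<Rightarrow> bool" where
  "pluggable ps G \<longleftrightarrow> aromatic G \<and> distinct (map fst ps) \<and> fst ` set ps \<subseteq> pverts G"

lemma pluggable_replace_node:
  assumes "pluggable ((v, \<sigma>) # ps) G" "aromatic T" "pverts G \<inter> pverts T = {}"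
    and "f \<in> preds G v \<rightarrow>\<^sub>E pverts T"
  shows "pluggable ps (replace_node G v T f)"
  using assms aromatic_replace_node[of G T v f] unfolding pluggable_def
  by (auto simp: replace_node_def)

text \<open>
  Insertion respects isomorphism, with the marked nodes carried along. The fresh copies that are
  inserted into \<open>G\<close> and into its image differ, but they are isomorphic; gluing this isomorphism
  to \<open>\<phi>\<close> matches the graphs after one insertion, and the induction continues with the glued map.
\<close>

lemma plug_map_graph:
  assumes "pluggable ps G" "inj_on \<phi> (pverts G)"
  shows "plug (map (apfst \<phi>) ps) (map_graph \<phi> G) = plug ps G"
  using assms
proof (induction ps arbitrary: G \<phi>)
  case Nil
  then have "aromatic G" by (simp add: pluggable_def)
  then have "abs_aromatic_tree G = abs_aromatic_tree (map_graph \<phi> G)"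
    using abs_aromatic_tree_eq_iff aromatic_map_graph aromatic_iso_map_graph Nil by blast
  then show ?case
    by (simp add: plug_Nil)
next
  case (Cons p ps)
  obtain v \<sigma> where p: "p = (v, \<sigma>)" by (cases p)
  let ?H = "map_graph \<phi> G"
  from Cons.prems p have G: "aromatic G" "v \<in> pverts G" "fst ` set ps \<subseteq> pverts G"
    by (auto simp: pluggable_def)
  have H: "aromatic ?H"
    using G(1) Cons.prems(2) by (rule aromatic_map_graph)
  have "(\<Sum>f \<in> preds ?H (\<phi> v) \<rightarrow>\<^sub>E pverts (fresh_copy ?H (rep_aromatic_tree t)).
       plug (map (apfst \<phi>) ps) (replace_node ?H (\<phi> v) (fresh_copy ?H (rep_aromatic_tree t)) f))
    = (\<Sum>f \<in> preds G v \<rightarrow>\<^sub>E pverts (fresh_copy G (rep_aromatic_tree t)).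
       plug ps (replace_node G v (fresh_copy G (rep_aromatic_tree t)) f))" for t
  proof -
    let ?T = "fresh_copy G (rep_aromatic_tree t)" and ?S = "fresh_copy ?H (rep_aromatic_tree t)"
    have T: "aromatic ?T" "aromatic ?S"
      using aromatic_fresh_copy aromatic_rep by blast+
    have "aromatic_iso ?T ?S"
      using abs_aromatic_tree_eq_iff[OF T] abs_fresh_copy[OF aromatic_rep] by simp
    then obtain \<psi> where \<psi>: "inj_on \<psi> (pverts ?T)" "?S = map_graph \<psi> ?T"
      by (rule aromatic_isoE)
    have disj: "pverts G \<inter> pverts ?T = {}" "pverts ?H \<inter> pverts ?S = {}"
      using fresh_copy_disjoint finite_pverts G(1) H by blast+
    obtain \<chi> where \<chi>: "inj_on \<chi> (pverts G \<union> pverts ?T)" "\<And>u. u \<in> pverts G \<Longrightarrow> \<chi> u = \<phi> u"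
      "map_graph \<chi> G = ?H" "map_graph \<chi> ?T = ?S"
    proof (rule glue_injections[OF Cons.prems(2) \<psi>(1) disj(1) _ G(1) T(1)])
      show "\<phi> ` pverts G \<inter> \<psi> ` pverts ?T = {}"
        using disj(2) \<psi>(2) by simp
    qed (simp add: \<psi>(2) that)
    have ps: "map (apfst \<phi>) ps = map (apfst \<chi>) ps"
      using G(3) \<chi>(2) by (auto simp: apfst_def map_prod_def)
    have "(\<Sum>f \<in> preds ?H (\<phi> v) \<rightarrow>\<^sub>E pverts ?S. plug (map (apfst \<phi>) ps) (replace_node ?H (\<phi> v) ?S f))
      = (\<Sum>f \<in> preds G v \<rightarrow>\<^sub>E pverts ?T. plug (map (apfst \<chi>) ps) (map_graph \<chi> (replace_node G v ?T f)))"
      using sum_replace_node_map_graph[OF G(1) T(1) G(2) disj(1) \<chi>(1),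
          of "plug (map (apfst \<chi>) ps)"] \<chi>(2)[OF G(2)] \<chi>(3,4)
      by (simp only: ps)
    also have "\<dots> = (\<Sum>f \<in> preds G v \<rightarrow>\<^sub>E pverts ?T. plug ps (replace_node G v ?T f))"
    proof (rule sum.cong[OF refl])
      fix f assume f: "f \<in> preds G v \<rightarrow>\<^sub>E pverts ?T"
      have "pverts (replace_node G v ?T f) \<subseteq> pverts G \<union> pverts ?T"
        by (auto simp: replace_node_def)
      then show "plug (map (apfst \<chi>) ps) (map_graph \<chi> (replace_node G v ?T f))
          = plug ps (replace_node G v ?T f)"
        using Cons.prems(1) T(1) disj(1) f \<chi>(1) unfolding p
        by (intro Cons.IH pluggable_replace_node) (auto intro: inj_on_subset)
    qed
    finally show ?thesis .
  qed
  then show ?case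
    by (simp add: p plug_Cons)
qed

text \<open>
  The fresh copy in the definition of an insertion may be replaced by any disjoint representative of
  the same isomorphism class. This frees later arguments from the arithmetic of fresh names.
\<close>

lemma plug_Cons_basis:
  assumes ps: "pluggable ((v, basis t) # ps) G"
    and T: "aromatic T" "abs_aromatic_tree T = t" "pverts G \<inter> pverts T = {}"
  shows "plug ((v, basis t) # ps) G = (\<Sum>f \<in> preds G v \<rightarrow>\<^sub>E pverts T. plug ps (replace_node G v T f))"
proof -
  let ?S = "fresh_copy G (rep_aromatic_tree t)"
  from ps have G: "aromatic G" "v \<in> pverts G" "fst ` set ps \<subseteq> pverts G"
    by (auto simp: pluggable_def)
  have S: "aromatic ?S"
    using aromatic_fresh_copy aromatic_rep by blast
  have "aromatic_iso T ?S"
    using abs_aromatic_tree_eq_iff[OF T(1) S] T(2) by (simp add: abs_fresh_copy aromatic_rep abs_rep)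
  then obtain \<psi> where \<psi>: "inj_on \<psi> (pverts T)" "?S = map_graph \<psi> T"
    by (rule aromatic_isoE)
  have disj: "pverts G \<inter> pverts ?S = {}"
    using fresh_copy_disjoint finite_pverts G(1) by blast
  have id: "map_graph id G = G"
    by (simp add: map_graph_def map_prod.id)
  obtain \<chi> where \<chi>: "inj_on \<chi> (pverts G \<union> pverts T)" "\<And>u. u \<in> pverts G \<Longrightarrow> \<chi> u = u"
    "map_graph \<chi> G = G" "map_graph \<chi> T = ?S"
  proof (rule glue_injections[OF inj_on_id \<psi>(1) T(3) _ G(1) T(1)])
    show "id ` pverts G \<inter> \<psi> ` pverts T = {}"
      using disj \<psi>(2) by simp
  qed (simp add: \<psi>(2) id that)
  have ps_\<chi>: "map (apfst \<chi>) ps = ps"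
    using G(3) \<chi>(2) by (auto simp: apfst_def map_prod_def intro!: map_idI)
  have "plug ((v, basis t) # ps) G
      = (\<Sum>f \<in> preds G v \<rightarrow>\<^sub>E pverts T. plug (map (apfst \<chi>) ps) (map_graph \<chi> (replace_node G v T f)))"
    using sum_replace_node_map_graph[OF G(1) T(1) G(2) T(3) \<chi>(1), of "plug ps"] \<chi>(2)[OF G(2)] \<chi>(3,4)
    by (simp add: plug_Cons ps_\<chi>)
  also have "\<dots> = (\<Sum>f \<in> preds G v \<rightarrow>\<^sub>E pverts T. plug ps (replace_node G v T f))"
  proof (rule sum.cong[OF refl])
    fix f assume f: "f \<in> preds G v \<rightarrow>\<^sub>E pverts T"
    have "pverts (replace_node G v T f) \<subseteq> pverts G \<union> pverts T"
      by (auto simp: replace_node_def)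
    then show "plug (map (apfst \<chi>) ps) (map_graph \<chi> (replace_node G v T f))
        = plug ps (replace_node G v T f)"
      using pluggable_replace_node[OF ps T(1,3) f] \<chi>(1)
      by (intro plug_map_graph) (auto intro: inj_on_subset)
  qed
  finally show ?thesis .
qed

section \<open>Commutation of insertions\<close>

text \<open>
  Both grafting functions are indexed by predecessors in the original graph, which is what makes the
  description symmetric in the two nodes.
\<close>

definition replace_two ::
  "graph \<Rightarrow> nat \<Rightarrow> graph \<Rightarrow> (nat \<Rightarrow> nat) \<Rightarrow> nat \<Rightarrow> graph \<Rightarrow> (nat \<Rightarrow> nat) \<Rightarrow> graph" where
  "replace_two G v T f w S g =
     \<lparr> pverts = (pverts G - {v, w}) \<union> pverts T \<union> pverts S,
       parcs = parcs T \<union> parcs S \<union>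
         (\<lambda>(u, x). (if u = v then root_node T else if u = w then root_node S else u,
                    if x = v then f u else if x = w then g u else x)) ` parcs G \<rparr>"

lemma replace_two_commute:
  assumes "v \<noteq> w"
  shows "replace_two G v T f w S g = replace_two G w S g v T f"
proof -
  have "(\<lambda>(u, x). (if u = v then root_node T else if u = w then root_node S else u,
                    if x = v then f u else if x = w then g u else x))
    = (\<lambda>(u, x). (if u = w then root_node S else if u = v then root_node T else u,
                    if x = w then g u else if x = v then f u else x))"
    using assms by (auto simp: fun_eq_iff)
  then show ?thesis
    by (simp add: replace_two_def Un_ac insert_commute)
qed

text \<open>
  The arc of \<open>v\<close> is taken over by the root of \<open>T\<close>; hence, if \<open>v\<close> precedes \<open>w\<close>, the root takes its place
  among the predecessors of \<open>w\<close>. The arcs redirected to nodes of \<open>T\<close> never reach \<open>w\<close>.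
\<close>

lemma preds_replace_node:
  assumes "aromatic G" "aromatic T" "w \<in> pverts G" "w \<noteq> v" "pverts G \<inter> pverts T = {}"
    and f: "f \<in> preds G v \<rightarrow>\<^sub>E pverts T"
  shows "preds (replace_node G v T f) w = (\<lambda>u. if u = v then root_node T else u) ` preds G w"
proof (intro set_eqI iffI)
  fix y assume "y \<in> preds (replace_node G v T f) w"
  then have "(y, w) \<in> parcs T \<union>
      (\<lambda>(u, x). (if u = v then root_node T else u, if x = v then f u else x)) ` parcs G"
    by (simp add: preds_def replace_node_def)
  moreover have "(y, w) \<notin> parcs T"
    using aromatic_arcD(2)[OF assms(2)] assms(3,5) by blast
  ultimately obtain e where e: "e \<in> parcs G"
      "(y, w) = (\<lambda>(u, x). (if u = v then root_node T else u, if x = v then f u else x)) e"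
    by blast
  then obtain u x where ux: "(u, x) \<in> parcs G"
      "y = (if u = v then root_node T else u)" "w = (if x = v then f u else x)"
    by (cases e) simp
  have "x \<noteq> v"
  proof
    assume "x = v"
    then have "f u \<in> pverts T"
      using f ux(1) by (intro PiE_mem[OF f]) (simp add: preds_def)
    then show False
      using ux(3) \<open>x = v\<close> assms(3,5) by auto
  qed
  then show "y \<in> (\<lambda>u. if u = v then root_node T else u) ` preds G w"
    using ux by (auto simp: preds_def)
next
  fix y assume "y \<in> (\<lambda>u. if u = v then root_node T else u) ` preds G w"
  then obtain u where "(u, w) \<in> parcs G" "y = (if u = v then root_node T else u)"
    by (auto simp: preds_def)
  then show "y \<in> preds (replace_node G v T f) w"
    using assms(4) by (force simp: preds_def replace_node_def)
qed

lemma inj_on_redirect_root: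
  assumes "aromatic G" "aromatic T" "pverts G \<inter> pverts T = {}"
  shows "inj_on (\<lambda>u. if u = v then root_node T else u) (preds G w)"
proof (rule inj_on_subset[OF _ preds_subset[OF assms(1)]])
  have "root_node T \<notin> pverts G"
    using aromatic_root(2)[OF assms(2)] assms(3) by blast
  then show "inj_on (\<lambda>u. if u = v then root_node T else u) (pverts G)"
    by (auto intro!: inj_onI split: if_splits)
qed

text \<open>
  Two successive replacements amount to the simultaneous one, on the nose. The second grafting
  function is indexed by predecessors in the intermediate graph, which correspond to those in \<open>G\<close>
  through \<open>a\<close>.
\<close>

lemma replace_node_replace_node:
  fixes G T S f g v w
  defines "a \<equiv> (\<lambda>u. if u = v then root_node T else u)"
  assumes "aromatic G" "aromatic T" "v \<in> pverts G" "w \<in> pverts G" "w \<noteq> v"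
    and "pverts G \<inter> pverts T = {}" and f: "f \<in> preds G v \<rightarrow>\<^sub>E pverts T"
  shows "replace_node (replace_node G v T f) w S (\<lambda>y\<in>a ` preds G w. g (inv_into (preds G w) a y))
    = replace_two G v T f w S g" (is "replace_node _ w S ?g = _")
proof -
  let ?F = "\<lambda>(u, x). (if u = w then root_node S else u, if x = w then ?g u else x)"
  let ?A = "\<lambda>(u, x). (if u = v then root_node T else u, if x = v then f u else x)"
  let ?B = "\<lambda>(u, x). (if u = v then root_node T else if u = w then root_node S else u,
    if x = v then f u else if x = w then g u else x)"
  have wT: "w \<notin> pverts T" "root_node T \<noteq> w"
    using assms(5,7) aromatic_root(2)[OF assms(3)] by auto
  have inj: "inj_on a (preds G w)"
    unfolding a_def using assms(2,3,7) by (rule inj_on_redirect_root)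
  have FT: "?F e = e" if "e \<in> parcs T" for e
    using that wT(1) aromatic_arcD[OF assms(3)] by (cases e) auto
  have FA: "?F (?A e) = ?B e" if "e \<in> parcs G" for e
  proof -
    obtain u x where e: "e = (u, x)" by (cases e)
    have "f u \<noteq> w" if "x = v"
    proof -
      have "f u \<in> pverts T"
        using \<open>e \<in> parcs G\<close> that by (intro PiE_mem[OF f]) (simp add: preds_def e)
      then show ?thesis using wT(1) by blast
    qed
    moreover have "?g (a u) = g u" if "x = w"
    proof -
      have "u \<in> preds G w"
        using \<open>e \<in> parcs G\<close> that by (simp add: preds_def e)
      then show ?thesis
        by (simp add: inv_into_f_f[OF inj])
    qed
    ultimately show ?thesis
      using wT(2) assms(6) by (auto simp: e a_def)
  qed
  have arcs: "?F ` (parcs T \<union> ?A ` parcs G) = parcs T \<union> ?B ` parcs G"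
    using FT FA by (simp add: image_Un image_image cong: image_cong)
  have verts: "(pverts G - {v}) \<union> pverts T - {w} = (pverts G - {v, w}) \<union> pverts T"
    using wT(1) by blast
  show ?thesis
    using arcs verts by (simp add: replace_node_def[of "replace_node G v T f"] replace_two_def)
      (simp add: replace_node_def Un_ac)
qed

lemma plug_two_basis:
  assumes ps: "pluggable ((v, basis t) # (w, basis s) # ps) G"
    and T: "aromatic T" "abs_aromatic_tree T = t" "pverts G \<inter> pverts T = {}"
    and S: "aromatic S" "abs_aromatic_tree S = s" "pverts G \<inter> pverts S = {}"
    and TS: "pverts T \<inter> pverts S = {}"
  shows "plug ((v, basis t) # (w, basis s) # ps) G =
    (\<Sum>f \<in> preds G v \<rightarrow>\<^sub>E pverts T. \<Sum>g \<in> preds G w \<rightarrow>\<^sub>E pverts S. plug ps (replace_two G v T f w S g))"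
proof -
  from ps have G: "aromatic G" "v \<in> pverts G" "w \<in> pverts G" "w \<noteq> v"
    by (auto simp: pluggable_def)
  have "plug ((w, basis s) # ps) (replace_node G v T f)
      = (\<Sum>g \<in> preds G w \<rightarrow>\<^sub>E pverts S. plug ps (replace_two G v T f w S g))"
    if f: "f \<in> preds G v \<rightarrow>\<^sub>E pverts T" for f
  proof -
    let ?H = "replace_node G v T f" and ?a = "\<lambda>u. if u = v then root_node T else u"
    have "pverts ?H \<inter> pverts S = {}"
      using S(3) TS by (auto simp: replace_node_def)
    then have "plug ((w, basis s) # ps) ?H
        = (\<Sum>g \<in> ?a ` preds G w \<rightarrow>\<^sub>E id ` pverts S. plug ps (replace_node ?H w S g))"
      using plug_Cons_basis[OF pluggable_replace_node[OF ps T(1,3) f] S(1,2)]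
        preds_replace_node[OF G(1) T(1) G(3,4) T(3) f] by simp
    also have "\<dots> = (\<Sum>g \<in> preds G w \<rightarrow>\<^sub>E pverts S. plug ps (replace_two G v T f w S g))"
      unfolding sum_PiE_reindex[OF inj_on_redirect_root[OF G(1) T(1,3)] inj_on_id]
      by (simp only: id_apply replace_node_replace_node[OF G(1) T(1) G(2-4) T(3) f])
    finally show ?thesis .
  qed
  then show ?thesis
    unfolding plug_Cons_basis[OF ps T] by (intro sum.cong refl)
qed

text \<open>
  With representatives that are disjoint from the graph and from each other, both orders of insertion
  give the same double sum of simultaneous replacements.
\<close>

lemma plug_swap_basis:
  assumes "pluggable ((v, basis t) # (w, basis s) # ps) G"
  shows "plug ((v, basis t) # (w, basis s) # ps) G = plug ((w, basis s) # (v, basis t) # ps) G"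
proof -
  have ps': "pluggable ((w, basis s) # (v, basis t) # ps) G" and vw: "v \<noteq> w"
    using assms by (auto simp: pluggable_def)
  have fin: "finite (pverts G)"
    using assms by (simp add: pluggable_def finite_pverts)
  obtain T where T: "aromatic T" "abs_aromatic_tree T = t" "pverts G \<inter> pverts T = {}"
    using disjoint_representative[OF fin] .
  obtain S where S: "aromatic S" "abs_aromatic_tree S = s" "(pverts G \<union> pverts T) \<inter> pverts S = {}"
    using disjoint_representative[of "pverts G \<union> pverts T"] fin finite_pverts[OF T(1)] by blast
  then have disj: "pverts G \<inter> pverts S = {}" "pverts T \<inter> pverts S = {}" "pverts S \<inter> pverts T = {}"
    by auto
  show ?thesis
    unfolding plug_two_basis[OF assms T S(1,2) disj(1,2)] plug_two_basis[OF ps' S(1,2) disj(1) T disj(3)]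
    by (subst sum.swap) (simp add: replace_two_commute[OF vw])
qed

lemma linear_lie_node_arg: "linear (\<lambda>\<sigma>. lie_node v \<sigma> z)"
  unfolding lie_node_def lin_ext_def[of _ z]
  by (intro linear_compose_sum ballI linear_compose_scale_right linear_lin_ext)

lemma linear_plug_slot: "linear (\<lambda>\<sigma>. plug (ps @ (v, \<sigma>) # qs) G)"
  using linear_compose[OF linear_lie_node_arg linear_iso_classes_fold]
  by (simp add: plug_def o_def)

lemma plug_swap:
  assumes "pluggable ((v, \<sigma>) # (w, \<rho>) # ps) G"
  shows "plug ((v, \<sigma>) # (w, \<rho>) # ps) G = plug ((w, \<rho>) # (v, \<sigma>) # ps) G"
proof -
  have expand: "plug ((v, \<sigma>) # (w, \<rho>) # ps) G
      = lin_ext (\<lambda>t. lin_ext (\<lambda>s. plug ((v, basis t) # (w, basis s) # ps) G) \<rho>) \<sigma>" for v w \<sigma> \<rho>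
  proof -
    have "lin_ext (\<lambda>s. plug ((v, basis t) # (w, basis s) # ps) G) \<rho>
        = plug ((v, basis t) # (w, \<rho>) # ps) G" for t
      using linear_eq_lin_ext[OF linear_plug_slot[of "[(v, basis t)]" w ps G]] by simp
    then show ?thesis
      by (subst plug_Cons_lin_ext) simp
  qed
  have "plug ((v, basis t) # (w, basis s) # ps) G = plug ((w, basis s) # (v, basis t) # ps) G" for t s
    using assms by (intro plug_swap_basis) (simp add: pluggable_def)
  then show ?thesis
    \<comment> \<open>The equation must be instantiated: its right-hand side matches its left-hand side again.\<close>
    unfolding expand[of v \<sigma> w \<rho>] expand[of w \<rho> v \<sigma>] by (subst lin_ext_swap) (simp only:)
qed

lemma plug_Cons_cong:
  assumes "pluggable (p # ps) G" "pluggable (p # qs) G"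
    and "\<And>H. pluggable ps H \<Longrightarrow> pluggable qs H \<Longrightarrow> plug ps H = plug qs H"
  shows "plug (p # ps) G = plug (p # qs) G"
proof -
  obtain v \<sigma> where p: "p = (v, \<sigma>)" by (cases p)
  have "aromatic G"
    using assms(1) by (simp add: pluggable_def)
  then have disj: "pverts G \<inter> pverts (fresh_copy G T) = {}" for T
    by (intro fresh_copy_disjoint finite_pverts)
  have "plug ps (replace_node G v T f) = plug qs (replace_node G v T f)"
    if "T = fresh_copy G (rep_aromatic_tree t)" "f \<in> preds G v \<rightarrow>\<^sub>E pverts T" for t f T
    using assms that disj aromatic_fresh_copy[OF aromatic_rep] unfolding p
    by (intro assms(3) pluggable_replace_node) auto
  then show ?thesis
    by (simp add: p plug_Cons cong: sum.cong)
qed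

lemma pluggable_mset_cong:
  assumes "mset ps = mset qs"
  shows "pluggable ps G \<longleftrightarrow> pluggable qs G"
proof -
  have "distinct (map fst ps) \<longleftrightarrow> distinct (map fst qs)"
    using assms by (intro mset_eq_imp_distinct_iff) simp
  then show ?thesis
    using mset_eq_setD[OF assms] by (simp add: pluggable_def)
qed

lemma plug_move_to_front:
  assumes "pluggable (qs @ p # ps) G"
  shows "plug (qs @ p # ps) G = plug (p # qs @ ps) G"
  using assms
proof (induction qs arbitrary: G)
  case (Cons q qs)
  have q: "pluggable (q # p # qs @ ps) G"
    using Cons.prems by (subst pluggable_mset_cong) (auto simp: ac_simps)
  have "plug (q # qs @ p # ps) G = plug (q # p # qs @ ps) G"
    using Cons.prems q Cons.IH by (intro plug_Cons_cong) auto
  also have "\<dots> = plug (p # q # qs @ ps) G"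
    using q plug_swap by (cases q; cases p) auto
  finally show ?case by simp
qed simp

text \<open>
  Transpositions of neighbours generate all permutations, so the order of the insertions is immaterial.
\<close>

lemma plug_mset_cong:
  assumes "mset ps = mset qs" "pluggable ps G"
  shows "plug ps G = plug qs G"
  using assms
proof (induction ps arbitrary: qs G)
  case (Cons p ps)
  have "p \<in> set qs"
    using mset_eq_setD[OF Cons.prems(1)] by auto
  then obtain q1 q2 where qs: "qs = q1 @ p # q2"
    by (meson split_list)
  with Cons.prems(1) have ps: "mset ps = mset (q1 @ q2)"
    by simp
  have "pluggable qs G"
    using Cons.prems pluggable_mset_cong by blast
  moreover have "pluggable (p # q1 @ q2) G"
    using Cons.prems(2) ps by (subst pluggable_mset_cong[of _ "p # ps"]) auto
  then have "plug (p # ps) G = plug (p # q1 @ q2) G"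
    using Cons.prems(2) Cons.IH[OF ps] by (intro plug_Cons_cong)
  ultimately show ?case
    using plug_move_to_front[of q1 p q2 G] qs by simp
qed simp

section \<open>Insertion of a perturbed vertex\<close>

text \<open>
  All predecessors of \<open>v\<close> can only be grafted onto the one inserted vertex \<open>b\<close>, and a loop at \<open>v\<close>
  becomes a loop at \<open>b\<close>. So there is exactly one resulting graph, namely \<open>G\<close> with \<open>v\<close> renamed to \<open>b\<close>.
\<close>

lemma plug_bullet:
  assumes "pluggable ((v, bullet) # ps) G"
  shows "plug ((v, bullet) # ps) G = plug ps G"
proof -
  from assms have G: "aromatic G" "v \<in> pverts G" "v \<notin> fst ` set ps"
    and ps: "pluggable ps G"
    by (auto simp: pluggable_def)
  obtain b where b: "b \<notin> pverts G"
    using ex_new_if_finite[OF infinite_UNIV_nat finite_pverts[OF G(1)]] by blast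
  define T where "T = map_graph (\<lambda>_. b) bullet_graph"
  have inj: "inj_on (\<lambda>_. b) (pverts bullet_graph)"
    by (simp add: bullet_graph_def)
  have T: "aromatic T" "abs_aromatic_tree T = abs_aromatic_tree bullet_graph"
    using aromatic_map_graph[OF aromatic_bullet_graph inj] abs_aromatic_tree_eq_iff
      aromatic_iso_map_graph[OF aromatic_bullet_graph inj] aromatic_bullet_graph
    unfolding T_def by metis+
  have T_eq: "pverts T = {b}" "parcs T = {}"
    by (simp_all add: T_def bullet_graph_def)
  have root: "root_node T = b"
    using aromatic_root(2)[OF T(1)] T_eq by simp
  define \<phi> where "\<phi> u = (if u = v then b else u)" for u
  have \<phi>: "inj_on \<phi> (pverts G)"
    using b by (auto intro!: inj_onI simp: \<phi>_def split: if_splits)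
  have "(if u = v then b else u, if w = v then (\<lambda>x\<in>preds G v. b) u else w) = (\<phi> u, \<phi> w)"
    if "(u, w) \<in> parcs G" for u w
    using that by (auto simp: \<phi>_def preds_def)
  then have "(\<lambda>(u, w). (if u = v then b else u, if w = v then (\<lambda>x\<in>preds G v. b) u else w)) ` parcs G
      = map_prod \<phi> \<phi> ` parcs G"
    by (intro image_cong) auto
  moreover have "pverts G - {v} \<union> {b} = \<phi> ` pverts G"
    using G(2) by (auto simp: \<phi>_def)
  ultimately have R: "replace_node G v T (\<lambda>x\<in>preds G v. b) = map_graph \<phi> G"
    unfolding replace_node_def map_graph_def root T_eq by simp
  have "preds G v \<rightarrow>\<^sub>E pverts T = {\<lambda>x\<in>preds G v. b}"
    by (simp add: PiE_eq_singleton T_eq)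
  then have "plug ((v, bullet) # ps) G = plug ps (map_graph \<phi> G)"
    using plug_Cons_basis[OF assms[unfolded bullet_def] T] b R by (simp add: bullet_def T_eq)
  also have "\<dots> = plug (map (apfst \<phi>) ps) (map_graph \<phi> G)"
    using G(3) by (subst map_idI[of ps]) (force simp: \<phi>_def apfst_def map_prod_def)+
  also have "\<dots> = plug ps G"
    using ps \<phi> by (rule plug_map_graph)
  finally show ?thesis .
qed

text \<open>
  The sorted enumeration is only a choice: by commutation every enumeration of \<open>S\<close> gives the same
  value.
\<close>

definition plug_set :: "omega1 \<Rightarrow> nat set \<Rightarrow> graph \<Rightarrow> omega1" where
  "plug_set x S G = plug (map (\<lambda>v. (v, x)) (sorted_list_of_set S)) G"

lemma plug_eq_plug_set:
  assumes "aromatic G" "distinct vs" "set vs \<subseteq> pverts G"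
  shows "plug (map (\<lambda>v. (v, x)) vs) G = plug_set x (set vs) G"
  unfolding plug_set_def using assms
  by (intro plug_mset_cong) (auto simp: pluggable_def o_def mset_set_set[symmetric])

text \<open>
  The expansion of a product of sums: at each node either \<open>\<bullet>\<close>, which does nothing, or \<open>x\<close> is
  inserted, and \<open>S\<close> collects the nodes where it is \<open>x\<close>. The further insertions \<open>ps\<close> are present for the
  induction: an \<open>x\<close> chosen at the first node is moved behind the nodes still to be expanded.
\<close>

lemma plug_bullet_plus:
  assumes "pluggable (map (\<lambda>v. (v, bullet + x)) vs @ ps) G"
  shows "plug (map (\<lambda>v. (v, bullet + x)) vs @ ps) G
    = (\<Sum>S\<in>Pow (set vs). plug (map (\<lambda>v. (v, x)) (sorted_list_of_set S) @ ps) G)"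
  using assms
proof (induction vs arbitrary: ps)
  case Nil
  then show ?case by simp
next
  case (Cons v vs)
  let ?m = "map (\<lambda>v. (v, bullet + x)) vs"
  let ?s = "\<lambda>S. map (\<lambda>v. (v, x)) (sorted_list_of_set S)"
  have v: "v \<notin> set vs" and ps: "pluggable (?m @ ps) G"
    and v_ps: "pluggable ((v, \<sigma>) # ?m @ ps) G" for \<sigma>
    using Cons.prems by (auto simp: pluggable_def)
  have end_ps: "pluggable (?m @ (v, x) # ps) G"
    using v_ps[of x] by (subst pluggable_mset_cong) auto
  have "plug (?s S @ (v, x) # ps) G = plug (?s (insert v S) @ ps) G" if "S \<subseteq> set vs" for S
  proof -
    have S: "finite S" "v \<notin> S"
      using that v finite_subset by auto
    have "pluggable (?s S @ (v, x) # ps) G"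
      using end_ps that S(1) unfolding pluggable_def
      by (auto simp: o_def image_Un image_image)
    then show ?thesis
      using S by (intro plug_mset_cong) auto
  qed
  moreover have inj: "inj_on (insert v) (Pow (set vs))"
    using v by (intro inj_onI) (metis PowD insert_ident subsetD)
  ultimately have ins: "(\<Sum>S\<in>Pow (set vs). plug (?s S @ (v, x) # ps) G)
      = (\<Sum>S\<in>insert v ` Pow (set vs). plug (?s S @ ps) G)"
    using inj by (simp add: sum.reindex)
  have "plug (map (\<lambda>v. (v, bullet + x)) (v # vs) @ ps) G
      = plug ((v, bullet) # ?m @ ps) G + plug ((v, x) # ?m @ ps) G"
    using linear_add[OF linear_plug_slot[of "[]"]] by simp
  also have "\<dots> = plug (?m @ ps) G + plug (?m @ (v, x) # ps) G"
    using plug_bullet[OF v_ps] plug_move_to_front[OF end_ps] by simp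
  also have "\<dots> = (\<Sum>S\<in>Pow (set vs). plug (?s S @ ps) G)
      + (\<Sum>S\<in>insert v ` Pow (set vs). plug (?s S @ ps) G)"
    by (simp only: Cons.IH[OF ps] Cons.IH[OF end_ps] ins)
  also have "\<dots> = (\<Sum>S\<in>Pow (set (v # vs)). plug (?s S @ ps) G)"
    unfolding list.set Pow_insert using v by (intro sum.union_disjoint[symmetric]) auto
  finally show ?case .
qed

lemma substitute_all_bullet_plus:
  "substitute_all (bullet + x) g
    = (\<Sum>S\<in>Pow (pverts (rep_aromatic_tree g)). plug_set x S (rep_aromatic_tree g))"
proof -
  let ?G = "rep_aromatic_tree g"
  have G: "aromatic ?G" "finite (pverts ?G)"
    using aromatic_rep finite_pverts by blast+
  then have "pluggable (map (\<lambda>v. (v, bullet + x)) (sorted_list_of_set (pverts ?G)) @ []) ?G"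
    by (simp add: pluggable_def o_def image_image)
  from plug_bullet_plus[OF this] show ?thesis
    using G(2) by (simp add: substitute_all_def plug_def plug_set_def Let_def fold_map o_def)
qed

section \<open>Lie derivatives along tensor powers\<close>

lemma lie_word_summand:
  "iso_classes (foldr (\<lambda>(v, \<tau>). lie_node v \<tau>) ps (basis G)) = plug (rev ps) G"
  by (simp add: plug_def foldr_conv_fold)

text \<open>
  Grouping the tuples of distinct nodes by their underlying set \<open>S\<close>: all enumerations of \<open>S\<close>
  contribute equally, and there are \<open>n!\<close> of them.
\<close>

lemma lie_word_replicate:
  "lie_word (replicate n x) g = fact n *\<^sub>R
    (\<Sum>S | S \<subseteq> pverts (rep_aromatic_tree g) \<and> card S = n. plug_set x S (rep_aromatic_tree g))"
proof -
  define G where "G = rep_aromatic_tree g"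
  have G: "aromatic G" "finite (pverts G)"
    unfolding G_def using aromatic_rep finite_pverts by blast+
  define L where "L = {vs. length vs = n \<and> distinct vs \<and> set vs \<subseteq> pverts G}"
  define P where "P = {S. S \<subseteq> pverts G \<and> card S = n}"
  have "finite L"
    using finite_lists_length_eq[OF G(2), of n] unfolding L_def by (rule rev_finite_subset) auto
  have "finite P"
    using G(2) by (simp add: P_def)
  have "lie_word (replicate n x) g = (\<Sum>vs\<in>L. plug (rev (zip vs (replicate n x))) G)"
    by (simp add: lie_word_def lie_word_summand Let_def L_def G_def)
  also have "\<dots> = (\<Sum>vs\<in>L. plug_set x (set vs) G)"
  proof (rule sum.cong[OF refl])
    fix vs assume "vs \<in> L"
    then show "plug (rev (zip vs (replicate n x))) G = plug_set x (set vs) G"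
      using plug_eq_plug_set[OF G(1), of "rev vs" x]
      by (simp add: L_def zip_replicate2 rev_map)
  qed
  also have "\<dots> = (\<Sum>S\<in>P. \<Sum>vs | vs \<in> L \<and> set vs = S. plug_set x (set vs) G)"
    by (rule sum.group[symmetric, OF \<open>finite L\<close> \<open>finite P\<close>]) (auto simp: L_def P_def distinct_card)
  also have "\<dots> = (\<Sum>S\<in>P. fact n *\<^sub>R plug_set x S G)"
  proof (rule sum.cong[OF refl])
    fix S assume S: "S \<in> P"
    then have "{vs \<in> L. set vs = S} = permutations_of_set S"
      by (auto simp: L_def P_def permutations_of_set_def distinct_card)
    moreover have "card (permutations_of_set S) = fact n"
      using S finite_subset[OF _ G(2)] by (simp add: P_def card_permutations_of_set)
    ultimately show "(\<Sum>vs | vs \<in> L \<and> set vs = S. plug_set x (set vs) G) = fact n *\<^sub>R plug_set x S G"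
      using sum.cong[of "permutations_of_set S" _ "\<lambda>vs. plug_set x (set vs) G" "\<lambda>_. plug_set x S G"]
      by (simp add: permutations_of_set_def sum_constant_scaleR)
  qed
  finally show ?thesis
    by (simp add: scaleR_sum_right P_def G_def)
qed

primrec tensor_power :: "omega1 \<Rightarrow> nat \<Rightarrow> tensor" where
  "tensor_power x 0 = \<one>"
| "tensor_power x (Suc n) = tensor_of x \<otimes> tensor_power x n"

lemma lin_ext_tensor_power_Suc:
  "lin_ext h (tensor_power x (Suc n)) = lin_ext (\<lambda>t. lin_ext (\<lambda>w. h (t # w)) (tensor_power x n)) x"
  by (simp add: tensor_prod_def tensor_of_def lin_ext_linear_comp[OF linear_lin_ext])

lemma lin_ext_tensor_power_eq_sum:
  "lin_ext h (tensor_power x n) =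
    (\<Sum>w | set w \<subseteq> Poly_Mapping.keys x \<and> length w = n. prod_list (map (Poly_Mapping.lookup x) w) *\<^sub>R h w)"
proof (induction n arbitrary: h)
  case 0
  have "{w. set w \<subseteq> Poly_Mapping.keys x \<and> length w = 0} = {[]}"
    by auto
  then show ?case
    by (simp add: sym_one_def)
next
  case (Suc n)
  let ?K = "Poly_Mapping.keys x" and ?c = "\<lambda>w. prod_list (map (Poly_Mapping.lookup x) w)"
  let ?W = "{w. set w \<subseteq> ?K \<and> length w = n}"
  have "{w. set w \<subseteq> ?K \<and> length w = Suc n} = (\<lambda>(t, w). t # w) ` (?K \<times> ?W)"
    by (auto simp: length_Suc_conv)
  then have "(\<Sum>w | set w \<subseteq> ?K \<and> length w = Suc n. ?c w *\<^sub>R h w)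
      = (\<Sum>(t, w)\<in>?K \<times> ?W. ?c (t # w) *\<^sub>R h (t # w))"
    by (simp add: sum.reindex inj_on_def split_beta)
  also have "\<dots> = (\<Sum>t\<in>?K. \<Sum>w\<in>?W. ?c (t # w) *\<^sub>R h (t # w))"
    by (rule sum.cartesian_product[symmetric])
  also have "\<dots> = lin_ext h (tensor_power x (Suc n))"
    unfolding lin_ext_tensor_power_Suc Suc.IH by (simp add: lin_ext_def scaleR_sum_right)
  finally show ?case ..
qed

text \<open>
  The coefficient of a word in a tensor power is the product of the coefficients of its letters.
  It does not depend on their order, so every permutation of positions fixes the tensor power, and so
  does the average over all permutations.
\<close>

lemma symmetrize_tensor_power: "symmetrize (tensor_power x n) = tensor_power x n"
proof -
  let ?W = "{w. set w \<subseteq> Poly_Mapping.keys x \<and> length w = n}"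
  let ?c = "\<lambda>w. prod_list (map (Poly_Mapping.lookup x) w)"
  have invariant: "(\<Sum>w\<in>?W. ?c w *\<^sub>R basis (permute_list \<pi> w)) = tensor_power x n"
    if \<pi>: "\<pi> permutes {..<n}" for \<pi>
  proof -
    have inv: "inv \<pi> permutes {..<n}"
      using \<pi> by (rule permutes_inv)
    have c: "?c (permute_list \<pi> w) = ?c w" if "w \<in> ?W" for w
      using that \<pi> by (simp add: prod_mset_prod_list[symmetric])
    have "(\<Sum>w\<in>?W. ?c w *\<^sub>R basis (permute_list \<pi> w)) = (\<Sum>w\<in>?W. ?c w *\<^sub>R basis w)"
      using \<pi> inv c
      by (intro sum.reindex_bij_witness[where i = "permute_list (inv \<pi>)" and j = "permute_list \<pi>"])
        (auto simp: permute_list_compose[symmetric] permutes_inv_o)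
    also have "\<dots> = tensor_power x n"
      using lin_ext_tensor_power_eq_sum[of basis x n] by simp
    finally show ?thesis .
  qed
  have "symmetrize (tensor_power x n)
      = (\<Sum>w\<in>?W. \<Sum>\<pi> | \<pi> permutes {..<n}. (1 / fact n) *\<^sub>R ?c w *\<^sub>R basis (permute_list \<pi> w))"
    unfolding symmetrize_def lin_ext_tensor_power_eq_sum
    by (rule sum.cong) (simp_all add: scaleR_sum_right mult.commute)
  also have "\<dots> = (\<Sum>\<pi> | \<pi> permutes {..<n}. (1 / fact n) *\<^sub>R (\<Sum>w\<in>?W. ?c w *\<^sub>R basis (permute_list \<pi> w)))"
    by (subst sum.swap) (simp only: scaleR_sum_right)
  also have "\<dots> = (\<Sum>\<pi> | \<pi> permutes {..<n}. (1 / fact n) *\<^sub>R tensor_power x n)"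
    by (simp add: invariant)
  also have "\<dots> = tensor_power x n"
    by (simp add: sum_constant_scaleR card_permutations[of "{..<n}" n])
  finally show ?thesis .
qed

lemma sym_power_tensor_of: "sym_power (tensor_of x) n = tensor_power x n"
  by (induction n) (simp_all add: sym_prod_def symmetrize_tensor_power[of x "Suc _", simplified])

text \<open>
  The universal property of the tensor power: a multilinear map, extended from words of trees to
  tensors, sends the \<open>n\<close>-th power of \<open>x\<close> to its value at \<open>(x, \<dots>, x)\<close>.
\<close>

lemma lin_ext_tensor_power_multilinear:
  fixes h :: "omega1 list \<Rightarrow> 'b::real_vector"
  assumes "\<And>us ws. length us + Suc (length ws) = n \<Longrightarrow> linear (\<lambda>y. h (us @ y # ws))"
  shows "lin_ext (\<lambda>w. h (map basis w)) (tensor_power x n) = h (replicate n x)"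
  using assms
proof (induction n arbitrary: h)
  case 0
  then show ?case by (simp add: sym_one_def)
next
  case (Suc n)
  have "lin_ext (\<lambda>w. h (basis t # map basis w)) (tensor_power x n) = h (basis t # replicate n x)" for t
    using Suc.prems[of "basis t # _"] by (intro Suc.IH) simp
  then have "lin_ext (\<lambda>w. h (map basis w)) (tensor_power x (Suc n))
      = lin_ext (\<lambda>t. h (basis t # replicate n x)) x"
    unfolding lin_ext_tensor_power_Suc by simp
  also have "\<dots> = h (x # replicate n x)"
    using Suc.prems[of "[]" "replicate n x"] by (intro linear_eq_lin_ext) simp
  finally show ?case by simp
qed

lemma linear_lie_word_slot: "linear (\<lambda>y. lie_word (us @ y # ws) g)"
  unfolding lie_word_def Let_def lie_word_summand length_append list.size
proof (intro linear_compose_sum ballI)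
  fix vs assume "vs \<in> {vs. length vs = length us + (length ws + Suc 0) \<and> distinct vs
      \<and> set vs \<subseteq> pverts (rep_aromatic_tree g)}"
  then have len: "length us < length vs"
    by simp
  define vs1 v vs2
    where "vs1 = take (length us) vs" "v = vs ! length us" "vs2 = drop (Suc (length us)) vs"
  then have "vs = vs1 @ v # vs2" "length vs1 = length us"
    using id_take_nth_drop[OF len] len by simp_all
  then have "plug (rev (zip vs (us @ y # ws))) G
      = plug (rev (zip vs2 ws) @ (v, y) # rev (zip vs1 us)) G" for y G
    by simp
  then show "linear (\<lambda>y. plug (rev (zip vs (us @ y # ws))) (rep_aromatic_tree g))"
    using linear_plug_slot by simp
qed

lemma lie_tensor_sym_exp:
  "lie_tensor (sym_exp (tensor_of x) n) \<gamma> = lin_ext (\<lambda>g.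
    \<Sum>S | S \<subseteq> pverts (rep_aromatic_tree g) \<and> card S = n. plug_set x S (rep_aromatic_tree g)) \<gamma>"
proof -
  have "lin_ext (\<lambda>w. lie_word (map basis w) g) (tensor_power x n) = lie_word (replicate n x) g" for g
    by (rule lin_ext_tensor_power_multilinear) (rule linear_lie_word_slot)
  then show ?thesis
    by (simp add: lie_tensor_def sym_exp_def sym_power_tensor_of linear_scale[OF linear_lin_ext]
        lie_word_replicate)
qed

section \<open>The exponential series\<close>

text \<open>
  Only degrees up to the largest number of nodes in \<open>\<gamma>\<close> contribute, since larger sets of nodes do
  not exist. This makes the series a finite sum, which can be exchanged with the linear extension in
  \<open>\<gamma>\<close>.
\<close>

lemma lie_series_sym_exp:
  "lie_series (sym_exp (tensor_of x)) \<gamma>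
    = lin_ext (\<lambda>g. \<Sum>S\<in>Pow (pverts (rep_aromatic_tree g)). plug_set x S (rep_aromatic_tree g)) \<gamma>"
proof -
  let ?V = "\<lambda>g. pverts (rep_aromatic_tree g)"
  let ?e = "\<lambda>n g. \<Sum>S | S \<subseteq> ?V g \<and> card S = n. plug_set x S (rep_aromatic_tree g)"
  have fin: "finite (?V g)" for g
    using aromatic_rep finite_pverts by blast
  obtain N where "\<forall>c\<in>(\<lambda>g. card (?V g)) ` Poly_Mapping.keys \<gamma>. c \<le> N"
    using finite_nat_set_iff_bounded_le finite_imageI[OF finite_keys] by metis
  then have N: "card S \<le> N" if "g \<in> Poly_Mapping.keys \<gamma>" "S \<subseteq> ?V g" for g S
    using that card_mono[OF fin that(2)] by fastforce
  have zero: "lin_ext (?e n) \<gamma> = 0" if "n \<notin> {..N}" for n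
  proof -
    have "?e n g = 0" if "g \<in> Poly_Mapping.keys \<gamma>" for g
    proof -
      have "{S. S \<subseteq> ?V g \<and> card S = n} = {}"
        using N[OF that] \<open>n \<notin> {..N}\<close> by auto
      then show ?thesis by (simp only: sum.empty)
    qed
    then show ?thesis by (simp add: lin_ext_def)
  qed
  have "lie_series (sym_exp (tensor_of x)) \<gamma> = (\<Sum>n\<le>N. lin_ext (?e n) \<gamma>)"
    unfolding lie_series_def lie_tensor_sym_exp
    using zero by (intro Sum_any.expand_superset) auto
  also have "\<dots> = lin_ext (\<lambda>g. \<Sum>S\<in>Pow (?V g). plug_set x S (rep_aromatic_tree g)) \<gamma>"
    unfolding sum_lin_ext
  proof (rule lin_ext_cong)
    fix g assume g: "g \<in> Poly_Mapping.keys \<gamma>"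
    have "(\<Sum>n\<le>N. ?e n g)
        = (\<Sum>n\<in>{..N}. \<Sum>S | S \<in> Pow (?V g) \<and> card S = n. plug_set x S (rep_aromatic_tree g))"
      by simp
    also have "\<dots> = (\<Sum>S\<in>Pow (?V g). plug_set x S (rep_aromatic_tree g))"
      using fin N[OF g] by (intro sum.group) auto
    finally show "(\<Sum>n\<le>N. ?e n g) = (\<Sum>S\<in>Pow (?V g). plug_set x S (rep_aromatic_tree g))" .
  qed
  finally show ?thesis .
qed

section \<open>Scaling symmetric powers\<close>

lemma sym_prod_scaleR: "(a *\<^sub>R x) \<odot> (b *\<^sub>R y) = (a * b) *\<^sub>R (x \<odot> y)"
proof -
  have "(a *\<^sub>R x) \<otimes> (b *\<^sub>R y) = (a * b) *\<^sub>R (x \<otimes> y)"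
    unfolding tensor_prod_def linear_scale[OF linear_lin_ext]
    by (simp add: lin_ext_linear_comp[OF linear_scale_self, symmetric])
  then show ?thesis
    by (simp add: sym_prod_def symmetrize_def linear_scale[OF linear_lin_ext])
qed

lemma sym_power_scaleR: "sym_power (c *\<^sub>R a) n = c ^ n *\<^sub>R sym_power a n"
  by (induction n) (simp_all add: sym_prod_scaleR)

theorem proposition3p7:
  fixes \<tau> \<gamma> :: omega1 and \<epsilon> :: real
  assumes "\<epsilon> > 0"
  shows "(bullet + \<epsilon> *\<^sub>R \<tau>) \<triangleright> \<gamma> = lie_series (sym_exp (tensor_of (\<epsilon> *\<^sub>R \<tau>))) \<gamma>
    \<and> (\<forall>n. sym_exp (tensor_of (\<epsilon> *\<^sub>R \<tau>)) n = (\<epsilon> ^ n / fact n) *\<^sub>R sym_power (tensor_of \<tau>) n)"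
proof (intro conjI allI)
  show "(bullet + \<epsilon> *\<^sub>R \<tau>) \<triangleright> \<gamma> = lie_series (sym_exp (tensor_of (\<epsilon> *\<^sub>R \<tau>))) \<gamma>"
    unfolding substitution_def lie_series_sym_exp
    by (intro lin_ext_cong substitute_all_bullet_plus)
  show "sym_exp (tensor_of (\<epsilon> *\<^sub>R \<tau>)) n = (\<epsilon> ^ n / fact n) *\<^sub>R sym_power (tensor_of \<tau>) n" for n
    by (simp add: sym_exp_def tensor_of_def linear_scale[OF linear_lin_ext] sym_power_scaleR)
qed

end
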